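(* Let $\mathfrak u$ be a non-principal ultrafilter on $\mathbb N$. If a sequence of p.m.p. graphed groupoids $(\mathcal G_n,\Phi_n)$ and its ultraproduct graphed groupoid $(\mathcal G_{\mathfrak u},\Phi_{\mathfrak u})$ satisfy $\lim_{n\in\mathfrak u}\mathcal C(\Phi_n)=\mathcal C(\Phi_{\mathfrak u})<\infty$, then $$c\mathcal C_{\mathfrak u}((\mathcal G_n,\Phi_n)_n)=\mathcal C(\mathcal G_{\mathfrak u})\geq\lim_{n\in\mathfrak u}\mathcal C(\mathcal G_n).$$
   Context: Groupoids. Probability spaces $(X,\mu)$ are arbitrary (not necessarily standard). A countable fibred space over $(X,\mu)$ is a measure space $(\mathcal F,\tilde\mu)$ with a measurable map $\pi:\mathcal F\to X$ for which there are a measurable subset $\widetilde{\mathcal F}\subset X\times\mathbb N$ (with the product of $\mu$ and counting measure) and a bi-measurable measure-preserving bijection $u:\mathcal F\to\widetilde{\mathcal F}$ with $u(f)\in\{\pi(f)\}\times\mathbb N$. Fibred products $\mathcal F_1*\mathcal F_2=\{(a,b):\pi_1(a)=\pi_2(b)\}$ carry the $\sigma$-algebra induced from $X\times\mathbb N\times\mathbb N$. A p.m.p. groupoid $\mathcal G$ over $(X,\mu)$ is a groupoid with unit space $X\subset\mathcal G$, source and target maps $s,t:\mathcal G\to X$ (the product $gh$ is defined when $s(g)=t(h)$), equipped with a $\sigma$-algebra and a measure $\tilde\mu$ making both $(\mathcal G,s)$ and $(\mathcal G,t)$ countable fibred spaces over $X$, and such that inverse and product $(\mathcal G,s)*(\mathcal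 G,t)\to\mathcal G$ are measurable. A bisection is a measurable subset $\varphi\subset\mathcal G$ on which $s$ and $t$ are injective; $\varphi\psi=\{gh:g\in\varphi,h\in\psi,s(g)=t(h)\}$ and $\varphi^{-1}=\{g^{-1}:g\in\varphi\}$. A graphing is an at most countable ordered family $\Phi=(\varphi_i)_i$ of bisections, indexed by $\mathbb N$ or $\{1,\dots,N\}$; its cost is $\mathcal C(\Phi)=\sum_i\tilde\mu(\varphi_i)$. It is generating if the smallest groupoid containing all $\varphi_i$ is $\mathcal G$. A p.m.p. graphed groupoid $(\mathcal G,\Phi)$ is a p.m.p. groupoid with a prescribed generating graphing. $\mathcal C(\mathcal G)$ is the infimum of $\mathcal C(\Psi)$ over generating graphings $\Psi$ of $\mathcal G$. A word of length $k$ in a family of bisections is a product of $k$ of them or their inverses (the empty word being $X$). Combinatorial cost. For graphings $\Phi=(\varphi_i)$, $\Psi=(\psi_i)$ of $\mathcal G$ and a sequence $M=(M_k)_k\in\mathbb N^{\mathbb N}$, write $\Psi\subset_{c,M}\Phi$ if for every $k$ the bisection $\psi_k$ is, up to a $\tilde\mu$-null set, piecewise a restriction of words of length at most $M_k$ in $\varphi_1,\dots,\varphi_{M_k}$ and their inverses (i.e. contained in the union of these words). $\Phi$ and $\Psi$ are $M$-coarsely equivalent if $\Psi\subset_{c,M}\Phi$ and $\Phi\subset_{c,M}\Psi$. Put $\mathcal C_M(\mathcal G,\Phi)=\inf\{\mathcal C(\Psi):\Psi\ M\text{-coarsely equivalent to }\Phi\}$ and $c\mathcal C_{\mathfrak u}((\mathcal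 G_n,\Phi_n)_n)=\inf_{M\in\mathbb N^{\mathbb N}}\lim_{n\in\mathfrak u}\mathcal C_M(\mathcal G_n,\Phi_n)$. Ultraproduct. For $g\in\mathcal G$ let $\ell_\Phi(g)$ be the least $k$ such that $g$ belongs to a word of length at most $k$ in $\varphi_1,\dots,\varphi_k$ and their inverses ($\ell_\Phi=0$ on units). Classes of sequences modulo equality for $\mathfrak u$-almost every $n$ are written $[\cdot]_{\mathfrak u}$. For $(\mathcal G_n,\Phi_n)$ over $(X_n,\mu_n)$ with $\Phi_n=(\varphi_n^i)_i$, let $X_{\mathfrak u}=\prod_nX_n/\!\sim_{\mathfrak u}$ with its Loeb probability measure ($\mu_{\mathfrak u}([A_n]_{\mathfrak u})=\lim_{n\in\mathfrak u}\mu_n(A_n)$ for measurable $A_n\subset X_n$, and every measurable set is of this form up to a null set). The ultraproduct groupoid is $\mathcal G_{\mathfrak u}=\{(g_n)_n:\sup_n\ell_{\Phi_n}(g_n)<\infty\}/\!\sim_{\mathfrak u}$ over $X_{\mathfrak u}$ with coordinatewise operations. Its measure structure is characterized by: for measurable $E_n\subset\mathcal G_n$ on which $\ell_{\Phi_n}$ is bounded uniformly in $n$, $[E_n]_{\mathfrak u}$ is measurable, carries the Loeb measure structure and has $\tilde\mu_{\mathfrak u}([E_n]_{\mathfrak u})=\lim_{n\in\mathfrak u}\tilde\mu_n(E_n)$. Its graphing is $\Phi_{\mathfrak u}=([\varphi_n^i]_{\mathfrak u})_i$ (with $\varphi_n^i=\emptyset$ if $i$ is not an index of $\Phi_n$),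 which is generating. *)

theory Defs
  imports "HOL-Probability.Probability_Measure"
begin

section \<open>Countable fibred spaces\<close>

text \<open>The measurable subset of \<open>X \<times> \<nat>\<close> in the definition of a countable fibred space is
  \<open>u ` space F\<close>; the last conjunct of \<open>fibred_coding\<close> says that this set is measurable, that the
  inverse of \<open>u\<close> is measurable, and that \<open>u\<close> preserves the measure.\<close>

definition fibred_coding ::
    "'x measure \<Rightarrow> 'f measure \<Rightarrow> ('f \<Rightarrow> 'x) \<Rightarrow> ('f \<Rightarrow> 'x \<times> nat) \<Rightarrow> bool" where
  "fibred_coding X F \<pi> u \<longleftrightarrow>
     inj_on u (space F) \<and>
     (\<forall>f\<in>space F. fst (u f) = \<pi> f) \<and>
     u \<in> F \<rightarrow>\<^sub>M X \<Otimes>\<^sub>M count_space UNIV \<and>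
     (\<forall>A\<in>sets F. u ` A \<in> sets (X \<Otimes>\<^sub>M count_space UNIV) \<and>
        emeasure (X \<Otimes>\<^sub>M count_space UNIV) (u ` A) = emeasure F A)"

definition countable_fibred_space :: "'x measure \<Rightarrow> 'f measure \<Rightarrow> ('f \<Rightarrow> 'x) \<Rightarrow> bool" where
  "countable_fibred_space X F \<pi> \<longleftrightarrow> \<pi> \<in> F \<rightarrow>\<^sub>M X \<and> (\<exists>u. fibred_coding X F \<pi> u)"

text \<open>Only the \<open>\<sigma>\<close>-algebra of \<open>fibred_product\<close> is used. It does not depend on the codings
  \<open>u\<^sub>1\<close>, \<open>u\<^sub>2\<close>.\<close>

definition fibred_product ::
    "'x measure \<Rightarrow> 'f measure \<Rightarrow> ('f \<Rightarrow> 'x) \<Rightarrow> ('f \<Rightarrow> 'x \<times> nat) \<Rightarrow>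
     'g measure \<Rightarrow> ('g \<Rightarrow> 'x) \<Rightarrow> ('g \<Rightarrow> 'x \<times> nat) \<Rightarrow> ('f \<times> 'g) measure" where
  "fibred_product X F\<^sub>1 \<pi>\<^sub>1 u\<^sub>1 F\<^sub>2 \<pi>\<^sub>2 u\<^sub>2 =
     vimage_algebra {(a, b). a \<in> space F\<^sub>1 \<and> b \<in> space F\<^sub>2 \<and> \<pi>\<^sub>1 a = \<pi>\<^sub>2 b}
       (\<lambda>(a, b). (\<pi>\<^sub>1 a, snd (u\<^sub>1 a), snd (u\<^sub>2 b)))
       (X \<Otimes>\<^sub>M count_space UNIV \<Otimes>\<^sub>M count_space UNIV)"


section \<open>Probability measure preserving groupoids\<close>

record 'a groupoid =
  objects :: "'a measure"
  arrows :: "'a measure"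
  src :: "'a \<Rightarrow> 'a"
  tgt :: "'a \<Rightarrow> 'a"
  gmul :: "'a \<Rightarrow> 'a \<Rightarrow> 'a"
  ginv :: "'a \<Rightarrow> 'a"

abbreviation units :: "'a groupoid \<Rightarrow> 'a set" where
  "units G \<equiv> space (objects G)"

abbreviation carrier :: "'a groupoid \<Rightarrow> 'a set" where
  "carrier G \<equiv> space (arrows G)"

locale groupoid_laws =
  fixes G :: "'a groupoid"
  assumes units_subset: "units G \<subseteq> carrier G"
    and src_unit: "g \<in> carrier G \<Longrightarrow> src G g \<in> units G"
    and tgt_unit: "g \<in> carrier G \<Longrightarrow> tgt G g \<in> units G"
    and src_of_unit: "x \<in> units G \<Longrightarrow> src G x = x"
    and tgt_of_unit: "x \<in> units G \<Longrightarrow> tgt G x = x"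
    and mul_closed: "\<lbrakk>g \<in> carrier G; h \<in> carrier G; src G g = tgt G h\<rbrakk> \<Longrightarrow> gmul G g h \<in> carrier G"
    and src_mul: "\<lbrakk>g \<in> carrier G; h \<in> carrier G; src G g = tgt G h\<rbrakk> \<Longrightarrow> src G (gmul G g h) = src G h"
    and tgt_mul: "\<lbrakk>g \<in> carrier G; h \<in> carrier G; src G g = tgt G h\<rbrakk> \<Longrightarrow> tgt G (gmul G g h) = tgt G g"
    and mul_assoc: "\<lbrakk>g \<in> carrier G; h \<in> carrier G; k \<in> carrier G; src G g = tgt G h; src G h = tgt G k\<rbrakk>
          \<Longrightarrow> gmul G (gmul G g h) k = gmul G g (gmul G h k)"
    and mul_src: "g \<in> carrier G \<Longrightarrow> gmul G g (src G g) = g"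
    and tgt_mul_self: "g \<in> carrier G \<Longrightarrow> gmul G (tgt G g) g = g"
    and inv_closed: "g \<in> carrier G \<Longrightarrow> ginv G g \<in> carrier G"
    and src_inv: "g \<in> carrier G \<Longrightarrow> src G (ginv G g) = tgt G g"
    and tgt_inv: "g \<in> carrier G \<Longrightarrow> tgt G (ginv G g) = src G g"
    and mul_inv: "g \<in> carrier G \<Longrightarrow> gmul G g (ginv G g) = tgt G g"
    and inv_mul: "g \<in> carrier G \<Longrightarrow> gmul G (ginv G g) g = src G g"

locale pmp_groupoid = groupoid_laws +
  assumes prob_objects: "prob_space (objects G)"
    and fibred_src: "countable_fibred_space (objects G) (arrows G) (src G)"
    and fibred_tgt: "countable_fibred_space (objects G) (arrows G) (tgt G)"
    and measurable_ginv: "ginv G \<in> arrows G \<rightarrow>\<^sub>M arrows G"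
    and measurable_gmul: "\<exists>u v. fibred_coding (objects G) (arrows G) (src G) u \<and>
          fibred_coding (objects G) (arrows G) (tgt G) v \<and>
          (\<lambda>(g, h). gmul G g h) \<in>
            fibred_product (objects G) (arrows G) (src G) u (arrows G) (tgt G) v \<rightarrow>\<^sub>M arrows G"


section \<open>Graphings and cost\<close>

definition bisection :: "'a groupoid \<Rightarrow> 'a set \<Rightarrow> bool" where
  "bisection G \<phi> \<longleftrightarrow> \<phi> \<in> sets (arrows G) \<and> inj_on (src G) \<phi> \<and> inj_on (tgt G) \<phi>"

definition set_mul :: "'a groupoid \<Rightarrow> 'a set \<Rightarrow> 'a set \<Rightarrow> 'a set" where
  "set_mul G \<phi> \<psi> = {gmul G g h | g h. g \<in> \<phi> \<and> h \<in> \<psi> \<and> src G g = tgt G h}"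

definition set_inv :: "'a groupoid \<Rightarrow> 'a set \<Rightarrow> 'a set" where
  "set_inv G \<phi> = ginv G ` \<phi>"

text \<open>The members of a graphing are numbered from \<open>1\<close>; the values of \<open>bis\<close> outside \<open>idx\<close> are
  irrelevant.\<close>

record 'a graphing =
  idx :: "nat set"
  bis :: "nat \<Rightarrow> 'a set"

definition is_graphing :: "'a groupoid \<Rightarrow> 'a graphing \<Rightarrow> bool" where
  "is_graphing G \<Phi> \<longleftrightarrow> (idx \<Phi> = {1..} \<or> (\<exists>N. idx \<Phi> = {1..N})) \<and>
     (\<forall>i\<in>idx \<Phi>. bisection G (bis \<Phi> i))"

definition graphing_cost :: "'a groupoid \<Rightarrow> 'a graphing \<Rightarrow> ennreal" where
  "graphing_cost G \<Phi> = (\<Sum>\<^sub>\<infinity>i\<in>idx \<Phi>. emeasure (arrows G) (bis \<Phi> i))"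

text \<open>Subgroupoids are over the same unit space \<open>X\<close>, in accordance with the convention that the
  empty word is \<open>X\<close>.\<close>

definition subgroupoid :: "'a groupoid \<Rightarrow> 'a set \<Rightarrow> bool" where
  "subgroupoid G H \<longleftrightarrow> units G \<subseteq> H \<and> H \<subseteq> carrier G \<and>
     (\<forall>g\<in>H. ginv G g \<in> H) \<and> (\<forall>g\<in>H. \<forall>h\<in>H. src G g = tgt G h \<longrightarrow> gmul G g h \<in> H)"

definition generating :: "'a groupoid \<Rightarrow> 'a graphing \<Rightarrow> bool" where
  "generating G \<Phi> \<longleftrightarrow> subgroupoid G hull (\<Union>i\<in>idx \<Phi>. bis \<Phi> i) = carrier G"

definition pmp_graphed_groupoid :: "'a groupoid \<Rightarrow> 'a graphing \<Rightarrow> bool" where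
  "pmp_graphed_groupoid G \<Phi> \<longleftrightarrow> pmp_groupoid G \<and> is_graphing G \<Phi> \<and> generating G \<Phi>"

definition groupoid_cost :: "'a groupoid \<Rightarrow> ennreal" where
  "groupoid_cost G = Inf {graphing_cost G \<Psi> | \<Psi>. is_graphing G \<Psi> \<and> generating G \<Psi>}"


section \<open>Words and combinatorial cost\<close>

definition letters :: "'a groupoid \<Rightarrow> 'a graphing \<Rightarrow> nat \<Rightarrow> 'a set set" where
  "letters G \<Phi> k = (\<Union>i\<in>{i\<in>idx \<Phi>. i \<le> k}. {bis \<Phi> i, set_inv G (bis \<Phi> i)})"

definition word :: "'a groupoid \<Rightarrow> 'a set list \<Rightarrow> 'a set" where
  "word G ws = foldr (set_mul G) ws (units G)"

text \<open>The union of the words of length at most \<open>k\<close> in the first \<open>k\<close> bisections.\<close>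

definition words_upto :: "'a groupoid \<Rightarrow> 'a graphing \<Rightarrow> nat \<Rightarrow> 'a set" where
  "words_upto G \<Phi> k = \<Union> {word G ws | ws. set ws \<subseteq> letters G \<Phi> k \<and> length ws \<le> k}"

definition glength :: "'a groupoid \<Rightarrow> 'a graphing \<Rightarrow> 'a \<Rightarrow> nat" where
  "glength G \<Phi> g = (LEAST k. g \<in> words_upto G \<Phi> k)"

text \<open>\<open>coarse_le G M \<Psi> \<Phi>\<close> is the relation \<open>\<Psi> \<subset>\<^bsub>c,M\<^esub> \<Phi>\<close>.\<close>

definition coarse_le :: "'a groupoid \<Rightarrow> (nat \<Rightarrow> nat) \<Rightarrow> 'a graphing \<Rightarrow> 'a graphing \<Rightarrow> bool" where
  "coarse_le G M \<Psi> \<Phi> \<longleftrightarrow>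
     (\<forall>k\<in>idx \<Psi>. AE g in arrows G. g \<in> bis \<Psi> k \<longrightarrow> g \<in> words_upto G \<Phi> (M k))"

definition coarse_equiv :: "'a groupoid \<Rightarrow> (nat \<Rightarrow> nat) \<Rightarrow> 'a graphing \<Rightarrow> 'a graphing \<Rightarrow> bool" where
  "coarse_equiv G M \<Psi> \<Phi> \<longleftrightarrow> coarse_le G M \<Psi> \<Phi> \<and> coarse_le G M \<Phi> \<Psi>"

definition coarse_cost :: "(nat \<Rightarrow> nat) \<Rightarrow> 'a groupoid \<Rightarrow> 'a graphing \<Rightarrow> ennreal" where
  "coarse_cost M G \<Phi> = Inf {graphing_cost G \<Psi> | \<Psi>. is_graphing G \<Psi> \<and> coarse_equiv G M \<Psi> \<Phi>}"

definition combinatorial_cost ::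
    "nat filter \<Rightarrow> (nat \<Rightarrow> 'a groupoid) \<Rightarrow> (nat \<Rightarrow> 'a graphing) \<Rightarrow> ennreal" where
  "combinatorial_cost U G \<Phi> = (INF M. Lim U (\<lambda>n. coarse_cost M (G n) (\<Phi> n)))"


section \<open>Ultrafilters and ultraproducts\<close>

text \<open>An ultrafilter \<open>U\<close> is represented by the filter whose eventually true predicates are the
  characteristic predicates of the members of \<open>U\<close>.\<close>

definition nonprincipal_ultrafilter :: "nat filter \<Rightarrow> bool" where
  "nonprincipal_ultrafilter U \<longleftrightarrow> U \<noteq> bot \<and>
     (\<forall>P. eventually P U \<or> eventually (\<lambda>n. \<not> P n) U) \<and>
     (\<forall>m. \<not> eventually (\<lambda>n. n = m) U)"

lemma tendsto_Lim_ultrafilter: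
  fixes f :: "nat \<Rightarrow> ennreal"
  assumes U: "nonprincipal_ultrafilter U"
  shows "(f \<longlongrightarrow> Lim U f) U"
proof -
  have nb: "U \<noteq> bot" and ult: "\<And>P. eventually P U \<or> eventually (\<lambda>n. \<not> P n) U"
    using U by (auto simp: nonprincipal_ultrafilter_def)
  have "Limsup U f \<le> Liminf U f"
  proof (rule ccontr)
    assume "\<not> Limsup U f \<le> Liminf U f"
    then have "Liminf U f < Limsup U f" by (simp add: not_le)
    then obtain c where c: "Liminf U f < c" "c < Limsup U f"
      by (rule dense[THEN exE]) auto
    from ult[of "\<lambda>n. c \<le> f n"] show False
    proof
      assume "\<forall>\<^sub>F n in U. c \<le> f n"
      then have "c \<le> Liminf U f" by (rule Liminf_bounded)
      with c show False by simp
    next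
      assume "\<forall>\<^sub>F n in U. \<not> c \<le> f n"
      then have "\<forall>\<^sub>F n in U. f n \<le> c" by (rule eventually_mono) auto
      then have "Limsup U f \<le> c" by (rule Limsup_bounded)
      with c show False by simp
    qed
  qed
  then have eq: "Limsup U f = Liminf U f"
    by (rule antisym) (rule Liminf_le_Limsup[OF nb])
  have "(f \<longlongrightarrow> Liminf U f) U"
    by (rule Liminf_eq_Limsup[OF nb refl eq])
  then show ?thesis
    using tendsto_Lim[OF nb] by metis
qed

definition ultra_eq :: "nat filter \<Rightarrow> ((nat \<Rightarrow> 'a) \<times> (nat \<Rightarrow> 'a)) set" where
  "ultra_eq U = {(x, y). \<forall>\<^sub>F n in U. x n = y n}"

definition ultra_class :: "nat filter \<Rightarrow> (nat \<Rightarrow> 'a) \<Rightarrow> (nat \<Rightarrow> 'a) set" where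
  "ultra_class U x = ultra_eq U `` {x}"

lemma equiv_ultra_eq: "equiv UNIV (ultra_eq U)"
proof (rule equivI)
  show "trans (ultra_eq U)"
  proof (rule transI)
    fix x y z assume "(x, y) \<in> ultra_eq U" "(y, z) \<in> ultra_eq U"
    then have "\<forall>\<^sub>F n in U. x n = y n" "\<forall>\<^sub>F n in U. y n = z n" by (simp_all add: ultra_eq_def)
    then have "\<forall>\<^sub>F n in U. x n = z n" by eventually_elim simp
    then show "(x, z) \<in> ultra_eq U" by (simp add: ultra_eq_def)
  qed
qed (simp_all add: ultra_eq_def refl_on_def sym_def eq_commute)

lemma ultra_class_eqI:
  assumes "\<forall>\<^sub>F n in U. x n = y n"
  shows "ultra_class U x = ultra_class U y"
  unfolding ultra_class_def using assms
  by (intro equiv_class_eq[OF equiv_ultra_eq]) (simp add: ultra_eq_def)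

lemma mem_ultra_class: "y \<in> ultra_class U x \<longleftrightarrow> (\<forall>\<^sub>F n in U. x n = y n)"
  by (simp add: ultra_class_def ultra_eq_def)

text \<open>Membership is only required \<open>U\<close>-almost everywhere: some of the \<open>A n\<close> may be empty even if
  \<open>U\<close>-almost all of them are not.\<close>

definition ultra_set :: "nat filter \<Rightarrow> (nat \<Rightarrow> 'a set) \<Rightarrow> (nat \<Rightarrow> 'a) set set" where
  "ultra_set U A = {x. \<forall>\<^sub>F n in U. x n \<in> A n} // ultra_eq U"

text \<open>The measure space on \<open>\<Omega>\<close> determined by prescribing the measure of the internal sets
  \<open>[A\<^sub>n]\<close>, for \<open>A\<close> in \<open>\<A>\<close>, to be the ultralimit of the measures of the \<open>A\<^sub>n\<close>: the extension to the
  generated \<open>\<sigma>\<close>-algebra, completed.\<close>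

definition loeb_measure ::
    "nat filter \<Rightarrow> (nat \<Rightarrow> 'a) set set \<Rightarrow> (nat \<Rightarrow> 'a set) set \<Rightarrow> (nat \<Rightarrow> 'a measure) \<Rightarrow>
     (nat \<Rightarrow> 'a) set measure" where
  "loeb_measure U \<Omega> \<A> M =
     completion (extend_measure \<Omega> \<A> (ultra_set U) (\<lambda>A. Lim U (\<lambda>n. emeasure (M n) (A n))))"

definition ultra_objects :: "nat filter \<Rightarrow> (nat \<Rightarrow> 'a groupoid) \<Rightarrow> (nat \<Rightarrow> 'a) set measure" where
  "ultra_objects U G =
     loeb_measure U ({x. \<forall>n. x n \<in> units (G n)} // ultra_eq U)
       {A. \<forall>n. A n \<in> sets (objects (G n))} (\<lambda>n. objects (G n))"

definition ultra_arrows ::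
    "nat filter \<Rightarrow> (nat \<Rightarrow> 'a groupoid) \<Rightarrow> (nat \<Rightarrow> 'a graphing) \<Rightarrow> (nat \<Rightarrow> 'a) set measure" where
  "ultra_arrows U G \<Phi> =
     loeb_measure U
       ({g. (\<forall>n. g n \<in> carrier (G n)) \<and> (\<exists>K. \<forall>n. glength (G n) (\<Phi> n) (g n) \<le> K)} // ultra_eq U)
       {E. (\<forall>n. E n \<in> sets (arrows (G n))) \<and> (\<exists>K. \<forall>n. \<forall>g\<in>E n. glength (G n) (\<Phi> n) g \<le> K)}
       (\<lambda>n. arrows (G n))"

text \<open>The unions over representatives are unions of equal classes.\<close>

definition ultra_map ::
    "nat filter \<Rightarrow> (nat \<Rightarrow> 'a \<Rightarrow> 'a) \<Rightarrow> (nat \<Rightarrow> 'a) set \<Rightarrow> (nat \<Rightarrow> 'a) set" where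
  "ultra_map U f c = (\<Union>x\<in>c. ultra_class U (\<lambda>n. f n (x n)))"

definition ultra_map2 ::
    "nat filter \<Rightarrow> (nat \<Rightarrow> 'a \<Rightarrow> 'a \<Rightarrow> 'a) \<Rightarrow> (nat \<Rightarrow> 'a) set \<Rightarrow> (nat \<Rightarrow> 'a) set \<Rightarrow>
     (nat \<Rightarrow> 'a) set" where
  "ultra_map2 U f c d = (\<Union>x\<in>c. \<Union>y\<in>d. ultra_class U (\<lambda>n. f n (x n) (y n)))"

lemma ultra_map_class: "ultra_map U f (ultra_class U x) = ultra_class U (\<lambda>n. f n (x n))"
proof -
  have "ultra_class U (\<lambda>n. f n (y n)) = ultra_class U (\<lambda>n. f n (x n))"
    if "y \<in> ultra_class U x" for y
  proof (rule ultra_class_eqI)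
    from that have "\<forall>\<^sub>F n in U. x n = y n" by (simp add: mem_ultra_class)
    then show "\<forall>\<^sub>F n in U. f n (y n) = f n (x n)" by eventually_elim simp
  qed
  moreover have "x \<in> ultra_class U x" by (simp add: mem_ultra_class)
  ultimately show ?thesis unfolding ultra_map_def by blast
qed

lemma ultra_map2_class:
  "ultra_map2 U f (ultra_class U x) (ultra_class U y) = ultra_class U (\<lambda>n. f n (x n) (y n))"
proof -
  have eq: "ultra_class U (\<lambda>n. f n (x' n) (y' n)) = ultra_class U (\<lambda>n. f n (x n) (y n))"
    if "x' \<in> ultra_class U x" "y' \<in> ultra_class U y" for x' y'
  proof (rule ultra_class_eqI)
    from that have "\<forall>\<^sub>F n in U. x n = x' n" "\<forall>\<^sub>F n in U. y n = y' n"
      by (simp_all add: mem_ultra_class)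
    then show "\<forall>\<^sub>F n in U. f n (x' n) (y' n) = f n (x n) (y n)" by eventually_elim simp
  qed
  have "x \<in> ultra_class U x" "y \<in> ultra_class U y"
    by (simp_all add: mem_ultra_class)
  with eq show ?thesis unfolding ultra_map2_def by blast
qed

definition ultra_groupoid ::
    "nat filter \<Rightarrow> (nat \<Rightarrow> 'a groupoid) \<Rightarrow> (nat \<Rightarrow> 'a graphing) \<Rightarrow> (nat \<Rightarrow> 'a) set groupoid" where
  "ultra_groupoid U G \<Phi> =
     \<lparr>objects = ultra_objects U G,
      arrows = ultra_arrows U G \<Phi>,
      src = ultra_map U (\<lambda>n. src (G n)),
      tgt = ultra_map U (\<lambda>n. tgt (G n)),
      gmul = ultra_map2 U (\<lambda>n. gmul (G n)),
      ginv = ultra_map U (\<lambda>n. ginv (G n))\<rparr>"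

definition ultra_graphing ::
    "nat filter \<Rightarrow> (nat \<Rightarrow> 'a graphing) \<Rightarrow> (nat \<Rightarrow> 'a) set graphing" where
  "ultra_graphing U \<Phi> =
     \<lparr>idx = {1..},
      bis = (\<lambda>i. ultra_set U (\<lambda>n. if i \<in> idx (\<Phi> n) then bis (\<Phi> n) i else {}))\<rparr>"

end

theory Submission
  imports Defs
begin

text \<open>Words of bounded length in almost optimal graphings \<open>\<Psi>\<^sub>n\<close>, \<open>M\<close>-coarsely equivalent to \<open>\<Phi>\<^sub>n\<close>, survive in
  the ultraproduct, so \<open>([\<psi>\<^sub>n\<^sup>k]\<^bsub>\<uu>\<^esub>)\<^sub>k\<close> generates \<open>\<G>\<^sub>\<uu>\<close> up to null sets. Adding countably many null
  bisections makes it generating without changing the cost, and a Fatou argument gives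
  \<open>\<C>(\<G>\<^sub>\<uu>) \<le> lim \<C>\<^sub>M(\<G>\<^sub>n, \<Phi>\<^sub>n)\<close>. The same addition of null bisections gives \<open>\<C>(\<G>\<^sub>n) \<le> \<C>\<^sub>M(\<G>\<^sub>n, \<Phi>\<^sub>n)\<close>.

  Conversely, let \<open>\<Psi>\<close> be a generating graphing of \<open>\<G>\<^sub>\<uu>\<close>. The Loeb measure is the outer measure
  determined by the internal sets of bounded length, and \<open>\<G>\<^sub>\<uu>\<close> is a disjoint union of countably many
  internal bisections; hence \<open>\<Psi>\<close> is covered by internal bisections \<open>[F\<^sub>m]\<close> of total cost at most
  \<open>\<C>(\<Psi>) + \<epsilon>\<close>. Since the \<open>[F\<^sub>m]\<close> contain \<open>\<Psi>\<close>, they still generate all of \<open>\<G>\<^sub>\<uu>\<close> and no null set has to be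
  discarded. By saturation each of the first \<open>K\<close> members of \<open>\<Phi>\<^sub>n\<close> lies in words of bounded length in
  \<open>F\<^sub>1, \<dots>, F\<^sub>J\<close> for almost all \<open>n\<close>. So \<open>F\<^sub>1, \<dots>, F\<^sub>J\<close> together with the rest of \<open>\<Phi>\<^sub>n\<close> is \<open>M\<close>-coarsely
  equivalent to \<open>\<Phi>\<^sub>n\<close>, and \<open>lim \<C>(\<Phi>\<^sub>n) = \<C>(\<Phi>\<^sub>\<uu>) < \<infinity>\<close> makes the rest cheap for large \<open>K\<close>.\<close>


section \<open>Words in a graphing\<close>

text \<open>Letters with an index outside \<open>idx \<Phi>\<close> are empty, so that the same finite set of codes serves all
  graphings.\<close>

definition letter :: "'a groupoid \<Rightarrow> 'a graphing \<Rightarrow> nat \<times> bool \<Rightarrow> 'a set" where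
  "letter G \<Phi> = (\<lambda>(i, b). if i \<in> idx \<Phi> then (if b then set_inv G (bis \<Phi> i) else bis \<Phi> i) else {})"

definition codes :: "nat \<Rightarrow> (nat \<times> bool) list set" where
  "codes k = {c. set c \<subseteq> {..k} \<times> UNIV \<and> length c \<le> k}"

abbreviation code_word :: "'a groupoid \<Rightarrow> 'a graphing \<Rightarrow> (nat \<times> bool) list \<Rightarrow> 'a set" where
  "code_word G \<Phi> c \<equiv> word G (map (letter G \<Phi>) c)"

lemma finite_codes: "finite (codes k)"
  unfolding codes_def by (rule finite_lists_length_le) auto

lemma codes_mono: "k \<le> l \<Longrightarrow> codes k \<subseteq> codes l"
  unfolding codes_def by force

lemma codes_append: "c \<in> codes k \<Longrightarrow> d \<in> codes l \<Longrightarrow> c @ d \<in> codes (k + l)"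
  unfolding codes_def by force

lemma set_mul_mono: "A \<subseteq> A' \<Longrightarrow> B \<subseteq> B' \<Longrightarrow> set_mul G A B \<subseteq> set_mul G A' B'"
  unfolding set_mul_def by blast

lemma set_mulI: "g \<in> A \<Longrightarrow> h \<in> B \<Longrightarrow> src G g = tgt G h \<Longrightarrow> gmul G g h \<in> set_mul G A B"
  unfolding set_mul_def by blast

lemma word_Nil [simp]: "word G [] = units G"
  by (simp add: word_def)

lemma word_Cons [simp]: "word G (w # ws) = set_mul G w (word G ws)"
  by (simp add: word_def)

lemma word_empty_letter: "{} \<in> set ws \<Longrightarrow> word G ws = {}"
  by (induction ws) (auto simp: set_mul_def)

text \<open>Words range over lists of sets, codes over a finite set that depends neither on
  \<open>G\<close> nor on \<open>\<Phi>\<close>. The finite union over codes yields measurability of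
  \<open>words_upto\<close> and, later, its compatibility with ultraproducts.\<close>

lemma words_upto_codes: "words_upto G \<Phi> k = (\<Union>c\<in>codes k. code_word G \<Phi> c)"
proof
  have letters: "letters G \<Phi> k = letter G \<Phi> ` {(i, b). i \<in> idx \<Phi> \<and> i \<le> k}"
    unfolding letters_def letter_def
    by (auto simp: image_iff split: if_splits) blast+
  show "words_upto G \<Phi> k \<subseteq> (\<Union>c\<in>codes k. code_word G \<Phi> c)"
  proof
    fix g assume "g \<in> words_upto G \<Phi> k"
    then obtain ws where ws: "set ws \<subseteq> letters G \<Phi> k" "length ws \<le> k" "g \<in> word G ws"
      unfolding words_upto_def by blast
    from ws(1) have "ws \<in> lists (letter G \<Phi> ` {(i, b). i \<in> idx \<Phi> \<and> i \<le> k})"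
      by (simp add: letters in_lists_conv_set subset_iff)
    then obtain c where c: "c \<in> lists {(i, b). i \<in> idx \<Phi> \<and> i \<le> k}" "ws = map (letter G \<Phi>) c"
      unfolding lists_image by blast
    then have "c \<in> codes k"
      using ws(2) by (auto simp: codes_def in_lists_conv_set)
    then show "g \<in> (\<Union>c\<in>codes k. code_word G \<Phi> c)"
      using c ws(3) by blast
  qed
  show "(\<Union>c\<in>codes k. code_word G \<Phi> c) \<subseteq> words_upto G \<Phi> k"
  proof safe
    fix g c assume c: "c \<in> codes k" and g: "g \<in> code_word G \<Phi> c"
    \<comment> \<open>A code with an index outside \<open>idx \<Phi>\<close> has an empty letter, so
      its word is empty and cannot contain \<open>g\<close>.\<close>
    have "i \<in> idx \<Phi>" if "(i, b) \<in> set c" for i b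
    proof (rule ccontr)
      assume "i \<notin> idx \<Phi>"
      then have "{} \<in> set (map (letter G \<Phi>) c)"
        using that by (force simp: letter_def)
      with g show False by (simp add: word_empty_letter)
    qed
    then have "set (map (letter G \<Phi>) c) \<subseteq> letters G \<Phi> k"
      using c unfolding letters codes_def by auto
    moreover have "length (map (letter G \<Phi>) c) \<le> k"
      using c by (simp add: codes_def)
    ultimately show "g \<in> words_upto G \<Phi> k"
      unfolding words_upto_def using g by blast
  qed
qed

lemma words_upto_mono: "k \<le> l \<Longrightarrow> words_upto G \<Phi> k \<subseteq> words_upto G \<Phi> l"
  unfolding words_upto_codes using codes_mono[of k l] by blast

lemma units_subset_words_upto: "units G \<subseteq> words_upto G \<Phi> k"
  unfolding words_upto_codes by (rule UN_upper[of "[]", THEN order_trans[rotated]]) (simp_all add: codes_def)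

lemma letter_cong_subset:
  assumes "idx \<Phi> \<inter> {..k} \<subseteq> idx \<Psi>" "\<And>i. i \<in> idx \<Phi> \<Longrightarrow> i \<le> k \<Longrightarrow> bis \<Phi> i \<subseteq> bis \<Psi> i"
    and "x \<in> {..k} \<times> UNIV"
  shows "letter G \<Phi> x \<subseteq> letter G \<Psi> x"
proof (cases x)
  case (Pair i b)
  then show ?thesis
    using assms(1,3) assms(2)[of i] by (auto simp: letter_def set_inv_def)
qed

lemma word_mono: "list_all2 (\<subseteq>) ws vs \<Longrightarrow> word G ws \<subseteq> word G vs"
  by (induction rule: list_all2_induct) (simp_all add: set_mul_mono)

text \<open>Only indices up to \<open>k\<close> occur in words at level \<open>k\<close>. This is
  how a family is later compared with a graphing that shares only its first members.\<close>

lemma words_upto_graphing_mono: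
  assumes "idx \<Phi> \<inter> {..k} \<subseteq> idx \<Psi>" "\<And>i. i \<in> idx \<Phi> \<Longrightarrow> i \<le> k \<Longrightarrow> bis \<Phi> i \<subseteq> bis \<Psi> i"
  shows "words_upto G \<Phi> k \<subseteq> words_upto G \<Psi> k"
proof -
  have "code_word G \<Phi> c \<subseteq> code_word G \<Psi> c" if "c \<in> codes k" for c
  proof (rule word_mono)
    have "letter G \<Phi> x \<subseteq> letter G \<Psi> x" if "x \<in> set c" for x
      using that \<open>c \<in> codes k\<close> by (intro letter_cong_subset[OF assms]) (auto simp: codes_def)
    then show "list_all2 (\<subseteq>) (map (letter G \<Phi>) c) (map (letter G \<Psi>) c)"
      by (simp add: list_all2_conv_all_nth)
  qed
  then show ?thesis unfolding words_upto_codes by blast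
qed

section \<open>Groupoid algebra and generation by words, in a locale that later also covers the
  ultraproduct\<close>

context groupoid_laws
begin

lemma ginv_ginv:
  assumes g: "g \<in> carrier G" shows "ginv G (ginv G g) = g"
proof -
  let ?h = "ginv G g"
  have "gmul G (gmul G (ginv G ?h) ?h) g = gmul G (ginv G ?h) (gmul G ?h g)"
    using g by (intro mul_assoc) (simp_all add: inv_closed src_inv tgt_inv)
  moreover have "gmul G (ginv G ?h) ?h = tgt G g"
    using g by (simp add: inv_mul inv_closed src_inv)
  moreover have "gmul G ?h g = src G (ginv G ?h)"
    using g by (simp add: inv_mul inv_closed src_inv tgt_inv)
  ultimately show ?thesis
    using g by (simp add: tgt_mul_self mul_src inv_closed)
qed

lemma inv_mul_cancel:
  assumes "a \<in> carrier G" "h \<in> carrier G" "src G a = tgt G h"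
  shows "gmul G (ginv G a) (gmul G a h) = h"
  using mul_assoc[of "ginv G a" a h] assms
  by (simp add: inv_closed src_inv inv_mul tgt_mul_self)

lemma mul_inv_cancel:
  assumes "a \<in> carrier G" "g \<in> carrier G" "tgt G a = tgt G g"
  shows "gmul G a (gmul G (ginv G a) g) = g"
  using mul_assoc[of a "ginv G a" g] assms
  by (simp add: inv_closed src_inv tgt_inv mul_inv tgt_mul_self)

text \<open>The candidate \<open>k\<close> satisfies \<open>(g h) k = t(g)\<close>; cancelling
  \<open>g h\<close> on the left identifies it with the inverse.\<close>

lemma ginv_mul:
  assumes g: "g \<in> carrier G" and h: "h \<in> carrier G" and gh: "src G g = tgt G h"
  shows "ginv G (gmul G g h) = gmul G (ginv G h) (ginv G g)"
proof -
  let ?k = "gmul G (ginv G h) (ginv G g)"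
  have k: "?k \<in> carrier G" "tgt G ?k = src G h"
    using assms by (simp_all add: mul_closed inv_closed src_inv tgt_inv tgt_mul)
  have "gmul G (gmul G g h) ?k = gmul G g (gmul G h ?k)"
    using assms k by (intro mul_assoc) auto
  also have "gmul G h ?k = ginv G g"
    using assms by (intro mul_inv_cancel) (simp_all add: inv_closed tgt_inv)
  also have "gmul G g (ginv G g) = tgt G g"
    using g by (rule mul_inv)
  finally have "gmul G (ginv G (gmul G g h)) (tgt G g) = ?k"
    using inv_mul_cancel[of "gmul G g h" ?k] assms k by (simp add: mul_closed src_mul)
  moreover have "src G (ginv G (gmul G g h)) = tgt G g"
    using assms by (simp add: mul_closed src_inv tgt_mul)
  ultimately show ?thesis
    using mul_src[of "ginv G (gmul G g h)"] assms by (simp add: inv_closed mul_closed)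
qed

lemma ginv_unit: "x \<in> units G \<Longrightarrow> ginv G x = x"
  using inv_mul_cancel[of x x] mul_src[of x] mul_src[of "ginv G x"] units_subset
  by (auto simp: inv_closed src_inv tgt_of_unit src_of_unit inv_mul subset_iff)

lemma set_inv_carrier: "A \<subseteq> carrier G \<Longrightarrow> set_inv G A \<subseteq> carrier G"
  by (auto simp: set_inv_def inv_closed)

lemma set_inv_set_inv: "A \<subseteq> carrier G \<Longrightarrow> set_inv G (set_inv G A) = A"
  by (force simp: set_inv_def image_iff ginv_ginv subset_iff)

lemma set_mul_carrier: "A \<subseteq> carrier G \<Longrightarrow> B \<subseteq> carrier G \<Longrightarrow> set_mul G A B \<subseteq> carrier G"
  by (auto simp: set_mul_def intro!: mul_closed)

lemma set_units_mul: "A \<subseteq> carrier G \<Longrightarrow> set_mul G A (units G) = A"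
proof
  assume A: "A \<subseteq> carrier G"
  have *: "gmul G g x = g" if "g \<in> A" "x \<in> units G" "src G g = tgt G x" for g x
    using mul_src[of g] A that tgt_of_unit[of x] by auto
  then show "set_mul G A (units G) \<subseteq> A"
    unfolding set_mul_def by auto
  show "A \<subseteq> set_mul G A (units G)"
  proof
    fix g assume "g \<in> A"
    then show "g \<in> set_mul G A (units G)"
      using A set_mulI[of g A "src G g" "units G" G]
      by (simp add: mul_src src_unit tgt_of_unit subset_iff)
  qed
qed

lemma word_carrier: "\<Union> (set ws) \<subseteq> carrier G \<Longrightarrow> word G ws \<subseteq> carrier G"
proof (induction ws)
  case Nil then show ?case by (simp add: units_subset)
next
  case (Cons w ws) then show ?case using set_mul_carrier[of w "word G ws"] by simp
qed

text \<open>\<open>word\<close> folds to the right and ends in the units, so the base case is left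
  multiplication by a unit and the induction step is associativity.\<close>

lemma word_append:
  assumes "\<Union> (set ws) \<subseteq> carrier G" "\<Union> (set vs) \<subseteq> carrier G"
    and "g \<in> word G ws" "h \<in> word G vs" "src G g = tgt G h"
  shows "gmul G g h \<in> word G (ws @ vs)"
  using assms(1,3,5)
proof (induction ws arbitrary: g)
  case Nil
  have "h \<in> carrier G" using word_carrier[OF assms(2)] assms(4) by blast
  with Nil have "gmul G g h = h"
    by (simp add: src_of_unit tgt_mul_self)
  with assms(4) show ?case by simp
next
  case (Cons w ws)
  then obtain a k where ak: "g = gmul G a k" "a \<in> w" "k \<in> word G ws" "src G a = tgt G k"
    by (auto simp: set_mul_def)
  have car: "a \<in> carrier G" "k \<in> carrier G" "h \<in> carrier G"
    using Cons.prems(1) ak word_carrier[of ws] word_carrier[OF assms(2)] assms(4) by auto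
  have kh: "src G k = tgt G h"
    using Cons.prems(3) ak car by (simp add: src_mul)
  have "gmul G k h \<in> word G (ws @ vs)"
    using Cons.prems ak kh by (intro Cons.IH) auto
  moreover have "gmul G g h = gmul G a (gmul G k h)"
    using ak car kh by (simp add: mul_assoc)
  ultimately show ?case
    using ak car kh by (auto intro!: set_mulI simp: tgt_mul)
qed

lemma word_ginv:
  assumes "\<Union> (set ws) \<subseteq> carrier G" "g \<in> word G ws"
  shows "ginv G g \<in> word G (rev (map (set_inv G) ws))"
  using assms
proof (induction ws arbitrary: g)
  case Nil then show ?case by (simp add: ginv_unit)
next
  case (Cons w ws)
  then obtain a k where ak: "g = gmul G a k" "a \<in> w" "k \<in> word G ws" "src G a = tgt G k"
    by (auto simp: set_mul_def)
  have car: "a \<in> carrier G" "k \<in> carrier G"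
    using Cons.prems(1) ak word_carrier[of ws] by auto
  have w: "set_inv G w \<subseteq> carrier G" "\<Union> (set (rev (map (set_inv G) ws))) \<subseteq> carrier G"
    using Cons.prems(1) by (auto simp: set_inv_def inv_closed subset_iff)
  have "ginv G a \<in> word G [set_inv G w]"
    using ak(2) by (simp add: set_units_mul[OF w(1)]) (simp add: set_inv_def)
  moreover have "ginv G k \<in> word G (rev (map (set_inv G) ws))"
    using Cons.prems(1) ak(3) by (intro Cons.IH) simp_all
  ultimately have "gmul G (ginv G k) (ginv G a) \<in> word G (rev (map (set_inv G) ws) @ [set_inv G w])"
    using w ak(4) car by (intro word_append) (simp_all add: src_inv tgt_inv)
  then show ?case using ak(1,4) car by (simp add: ginv_mul)
qed

context
  fixes \<Phi> :: "'a graphing"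
  assumes bis_carrier: "\<And>i. i \<in> idx \<Phi> \<Longrightarrow> bis \<Phi> i \<subseteq> carrier G"
begin

lemma letter_carrier: "letter G \<Phi> x \<subseteq> carrier G"
proof (cases "fst x \<in> idx \<Phi>")
  case True
  then show ?thesis
    using bis_carrier[OF True] set_inv_carrier[OF bis_carrier[OF True]]
    by (simp add: letter_def case_prod_unfold)
qed (simp add: letter_def case_prod_unfold)

lemma code_word_carrier: "code_word G \<Phi> c \<subseteq> carrier G"
  using letter_carrier by (intro word_carrier) auto

lemma words_upto_carrier: "words_upto G \<Phi> k \<subseteq> carrier G"
  unfolding words_upto_codes using code_word_carrier by blast

lemma words_upto_mul:
  assumes "g \<in> words_upto G \<Phi> k" "h \<in> words_upto G \<Phi> l" "src G g = tgt G h"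
  shows "gmul G g h \<in> words_upto G \<Phi> (k + l)"
proof -
  obtain c d where cd: "c \<in> codes k" "g \<in> code_word G \<Phi> c" "d \<in> codes l" "h \<in> code_word G \<Phi> d"
    using assms(1,2) unfolding words_upto_codes by blast
  have "gmul G g h \<in> code_word G \<Phi> (c @ d)"
    using word_append[OF _ _ cd(2,4) assms(3)] letter_carrier by (simp add: UN_least)
  then show ?thesis
    unfolding words_upto_codes using codes_append[OF cd(1,3)] by blast
qed

lemma set_inv_letter: "set_inv G (letter G \<Phi> x) = letter G \<Phi> (fst x, \<not> snd x)"
proof (cases "fst x \<in> idx \<Phi>")
  case True
  then show ?thesis
    using bis_carrier[OF True] by (simp add: letter_def set_inv_set_inv case_prod_unfold)
next
  case False
  then show ?thesis by (simp add: letter_def set_inv_def case_prod_unfold)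
qed

lemma words_upto_ginv:
  assumes "g \<in> words_upto G \<Phi> k"
  shows "ginv G g \<in> words_upto G \<Phi> k"
proof -
  obtain c where c: "c \<in> codes k" "g \<in> code_word G \<Phi> c"
    using assms unfolding words_upto_codes by blast
  define d where "d = rev (map (\<lambda>x. (fst x, \<not> snd x)) c)"
  have "ginv G g \<in> word G (rev (map (set_inv G) (map (letter G \<Phi>) c)))"
    using letter_carrier c by (intro word_ginv) auto
  moreover have "rev (map (set_inv G) (map (letter G \<Phi>) c)) = map (letter G \<Phi>) d"
    by (simp add: d_def set_inv_letter rev_map)
  moreover have "d \<in> codes k"
    using c(1) by (auto simp: d_def codes_def)
  ultimately show ?thesis
    unfolding words_upto_codes by auto
qed

lemma bis_subset_words_upto:
  assumes "i \<in> idx \<Phi>" "i \<le> k" "1 \<le> k"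
  shows "bis \<Phi> i \<subseteq> words_upto G \<Phi> k"
proof -
  have "code_word G \<Phi> [(i, False)] = bis \<Phi> i"
    using assms(1) bis_carrier by (simp add: letter_def set_units_mul)
  moreover have "[(i, False)] \<in> codes k"
    using assms by (simp add: codes_def)
  ultimately show ?thesis
    unfolding words_upto_codes by (metis UN_upper)
qed

lemma words_upto_subset_subgroupoid:
  assumes H: "subgroupoid G H" and bis: "\<And>i. i \<in> idx \<Phi> \<Longrightarrow> bis \<Phi> i \<subseteq> H"
  shows "words_upto G \<Phi> k \<subseteq> H"
proof -
  have letter: "letter G \<Phi> x \<subseteq> H" for x
    using H bis[of "fst x"] by (auto simp: letter_def set_inv_def subgroupoid_def case_prod_unfold)
  have "code_word G \<Phi> c \<subseteq> H" for c
  proof (induction c)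
    case Nil then show ?case using H by (simp add: subgroupoid_def)
  next
    case (Cons x c)
    show ?case
    proof
      fix g assume "g \<in> code_word G \<Phi> (x # c)"
      then obtain a h where "g = gmul G a h" "a \<in> letter G \<Phi> x" "h \<in> code_word G \<Phi> c" "src G a = tgt G h"
        unfolding set_mul_def list.map word_Cons by blast
      then show "g \<in> H"
        using H letter[of x] Cons unfolding subgroupoid_def by blast
    qed
  qed
  then show ?thesis unfolding words_upto_codes by blast
qed

lemma subgroupoid_words:
  "subgroupoid G (\<Union>k. words_upto G \<Phi> k)"
  unfolding subgroupoid_def
proof (intro conjI ballI impI)
  show "units G \<subseteq> (\<Union>k. words_upto G \<Phi> k)" using units_subset_words_upto[of G \<Phi> 0] by blast
  show "(\<Union>k. words_upto G \<Phi> k) \<subseteq> carrier G" using words_upto_carrier by blast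
  show "ginv G g \<in> (\<Union>k. words_upto G \<Phi> k)" if "g \<in> (\<Union>k. words_upto G \<Phi> k)" for g
    using that words_upto_ginv by blast
  show "gmul G g h \<in> (\<Union>k. words_upto G \<Phi> k)"
    if "g \<in> (\<Union>k. words_upto G \<Phi> k)" "h \<in> (\<Union>k. words_upto G \<Phi> k)" "src G g = tgt G h" for g h
    using that words_upto_mul by blast
qed

text \<open>The words of all lengths form a subgroupoid, and every subgroupoid containing the
  bisections contains them. Generation thus becomes exhaustion by an increasing sequence of sets,
  the form in which saturation applies.\<close>

lemma hull_eq_words:
  "subgroupoid G hull (\<Union>i\<in>idx \<Phi>. bis \<Phi> i) = (\<Union>k. words_upto G \<Phi> k)"
proof (rule hull_unique)
  show "(\<Union>i\<in>idx \<Phi>. bis \<Phi> i) \<subseteq> (\<Union>k. words_upto G \<Phi> k)"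
  proof safe
    fix i g assume "i \<in> idx \<Phi>" "g \<in> bis \<Phi> i"
    \<comment> \<open>The level \<open>i + 1\<close> is at least 1 even for \<open>i = 0\<close>, as
      a word of length one demands.\<close>
    then have "g \<in> words_upto G \<Phi> (i + 1)"
      using bis_subset_words_upto[of i "i + 1"] by auto
    then show "g \<in> (\<Union>k. words_upto G \<Phi> k)" by blast
  qed
  show "subgroupoid G (\<Union>k. words_upto G \<Phi> k)" by (rule subgroupoid_words)
  show "(\<Union>k. words_upto G \<Phi> k) \<subseteq> H" if "(\<Union>i\<in>idx \<Phi>. bis \<Phi> i) \<subseteq> H" "subgroupoid G H" for H
  proof (rule UN_least)
    show "words_upto G \<Phi> k \<subseteq> H" for k
      by (rule words_upto_subset_subgroupoid[OF that(2)]) (use that(1) in blast)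
  qed
qed

lemma generating_iff_words: "generating G \<Phi> \<longleftrightarrow> (\<Union>k. words_upto G \<Phi> k) = carrier G"
  by (simp add: generating_def hull_eq_words)

text \<open>For a generating graphing some level contains \<open>g\<close>, so the minimum in
  \<open>glength\<close> is attained, and the levels increase. Length bounds can therefore be read
  as membership in \<open>words_upto\<close>.\<close>

lemma glength_le_iff:
  assumes "generating G \<Phi>" "g \<in> carrier G"
  shows "glength G \<Phi> g \<le> K \<longleftrightarrow> g \<in> words_upto G \<Phi> K"
proof
  obtain k where k: "g \<in> words_upto G \<Phi> k"
    using assms by (auto simp: generating_iff_words)
  have "g \<in> words_upto G \<Phi> (glength G \<Phi> g)"
    unfolding glength_def by (rule LeastI[where P = "\<lambda>k. g \<in> words_upto G \<Phi> k", OF k])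
  then show "glength G \<Phi> g \<le> K \<Longrightarrow> g \<in> words_upto G \<Phi> K"
    using words_upto_mono[of "glength G \<Phi> g" K G \<Phi>] by blast
  show "g \<in> words_upto G \<Phi> K \<Longrightarrow> glength G \<Phi> g \<le> K"
    unfolding glength_def by (rule Least_le[where P = "\<lambda>k. g \<in> words_upto G \<Phi> k"])
qed

end

end


section \<open>Bisections of probability measure preserving groupoids\<close>

lemma is_graphing_idx: "is_graphing G \<Phi> \<Longrightarrow> i \<in> idx \<Phi> \<Longrightarrow> 1 \<le> i"
  unfolding is_graphing_def by auto

lemma is_graphing_bisection: "is_graphing G \<Phi> \<Longrightarrow> i \<in> idx \<Phi> \<Longrightarrow> bisection G (bis \<Phi> i)"
  unfolding is_graphing_def by auto

lemma bisection_carrier: "bisection G \<phi> \<Longrightarrow> \<phi> \<subseteq> carrier G"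
  unfolding bisection_def using sets.sets_into_space by auto

lemma is_graphing_carrier: "is_graphing G \<Phi> \<Longrightarrow> i \<in> idx \<Phi> \<Longrightarrow> bis \<Phi> i \<subseteq> carrier G"
  by (intro bisection_carrier is_graphing_bisection)

lemma bisection_empty: "bisection G {}"
  by (simp add: bisection_def)

lemma bisection_subset: "bisection G \<phi> \<Longrightarrow> \<psi> \<in> sets (arrows G) \<Longrightarrow> \<psi> \<subseteq> \<phi> \<Longrightarrow> bisection G \<psi>"
  unfolding bisection_def by (auto intro: inj_on_subset)

lemma bisection_Diff: "bisection G \<phi> \<Longrightarrow> A \<in> sets (arrows G) \<Longrightarrow> bisection G (\<phi> - A)"
  by (rule bisection_subset[of G \<phi>]) (auto simp: bisection_def)

lemma bisection_Int: "bisection G \<phi> \<Longrightarrow> A \<in> sets (arrows G) \<Longrightarrow> bisection G (\<phi> \<inter> A)"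
  by (rule bisection_subset[of G \<phi>]) (auto simp: bisection_def)

text \<open>The slices of \<open>u(A)\<close> over different natural numbers are disjoint subsets of
  \<open>X\<close> because \<open>\<pi>\<close> is injective on \<open>A\<close>. Their union is
  \<open>\<pi>(A)\<close>, and their measures add up to the product measure of \<open>u(A)\<close>.
  Hence a bisection has the measure of its source and of its target.\<close>

lemma fibred_coding_image:
  assumes u: "fibred_coding X F \<pi> u" and A: "A \<in> sets F" and inj: "inj_on \<pi> A"
  shows "\<pi> ` A \<in> sets X" "emeasure X (\<pi> ` A) = emeasure F A"
proof -
  interpret c: sigma_finite_measure "count_space (UNIV :: nat set)"
    by (rule sigma_finite_measure_count_space_countable) simp
  let ?P = "X \<Otimes>\<^sub>M count_space (UNIV :: nat set)"
  define S where "S j = (\<lambda>x. (x, j)) -` (u ` A)" for j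
  have AF: "A \<subseteq> space F" using A by (rule sets.sets_into_space)
  have uA: "u ` A \<in> sets ?P" "emeasure ?P (u ` A) = emeasure F A"
    using u A unfolding fibred_coding_def by auto
  have fst_u: "fst (u a) = \<pi> a" if "a \<in> A" for a
    using u that AF unfolding fibred_coding_def by auto
  have S: "S j \<in> sets X" for j
    unfolding S_def by (rule sets_Pair2[OF uA(1)])
  have disj: "disjoint_family S"
    unfolding disjoint_family_on_def
  proof (intro ballI impI equals0I)
    fix i j x assume "i \<noteq> j" "x \<in> S i \<inter> S j"
    then obtain a b where ab: "a \<in> A" "b \<in> A" "(x, i) = u a" "(x, j) = u b"
      unfolding S_def by auto
    then have "\<pi> a = \<pi> b"
      using fst_u[of a] fst_u[of b] by (metis fst_conv)
    then have "a = b" using inj ab by (auto dest: inj_onD)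
    with ab \<open>i \<noteq> j\<close> show False by (metis snd_conv)
  qed
  have img: "\<pi> ` A = (\<Union>j. S j)"
  proof (intro set_eqI iffI)
    fix x assume "x \<in> \<pi> ` A"
    then obtain a where a: "a \<in> A" "x = \<pi> a" by blast
    then have "(x, snd (u a)) \<in> u ` A" using fst_u[of a] by (metis image_eqI prod.collapse)
    then show "x \<in> (\<Union>j. S j)" by (auto simp: S_def)
  next
    fix x assume "x \<in> (\<Union>j. S j)"
    then obtain j a where "a \<in> A" "(x, j) = u a" by (auto simp: S_def)
    then show "x \<in> \<pi> ` A" using fst_u[of a] by (metis fst_conv image_eqI)
  qed
  have uA_eq: "u ` A = (\<Union>j. S j \<times> {j})"
    by (auto simp: S_def) 
  have "emeasure F A = emeasure ?P (\<Union>j. S j \<times> {j})"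
    using uA uA_eq by simp
  also have "\<dots> = (\<Sum>j. emeasure ?P (S j \<times> {j}))"
    using S by (intro suminf_emeasure[symmetric]) (auto simp: disjoint_family_on_def)
  also have "\<dots> = (\<Sum>j. emeasure X (S j))"
    using S by (simp add: c.emeasure_pair_measure_Times)
  also have "\<dots> = emeasure X (\<pi> ` A)"
    unfolding img using S disj by (intro suminf_emeasure) auto
  finally show "emeasure X (\<pi> ` A) = emeasure F A" ..
  show "\<pi> ` A \<in> sets X" unfolding img using S by auto
qed

section \<open>Measurability of units, inverses and products of bisections\<close>

context pmp_groupoid
begin

lemma measurable_src: "src G \<in> arrows G \<rightarrow>\<^sub>M objects G"
  using fibred_src by (simp add: countable_fibred_space_def)

lemma measurable_tgt: "tgt G \<in> arrows G \<rightarrow>\<^sub>M objects G"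
  using fibred_tgt by (simp add: countable_fibred_space_def)

lemma src_image:
  assumes "A \<in> sets (arrows G)" "inj_on (src G) A"
  shows "src G ` A \<in> sets (objects G)" "emeasure (objects G) (src G ` A) = emeasure (arrows G) A"
  using fibred_src fibred_coding_image[OF _ assms] unfolding countable_fibred_space_def by blast+

lemma tgt_image:
  assumes "A \<in> sets (arrows G)" "inj_on (tgt G) A"
  shows "tgt G ` A \<in> sets (objects G)" "emeasure (objects G) (tgt G ` A) = emeasure (arrows G) A"
  using fibred_tgt fibred_coding_image[OF _ assms] unfolding countable_fibred_space_def by blast+

text \<open>A map into the fibred product is measurable as soon as its three coordinates in
  \<open>X\<close>, \<open>nat\<close> and \<open>nat\<close> are. This turns the axiom on products
  into a rule for pointwise products of composable measurable maps.\<close>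

lemma measurable_gmul_comp:
  assumes f: "f \<in> N \<rightarrow>\<^sub>M arrows G" and h: "h \<in> N \<rightarrow>\<^sub>M arrows G"
    and eq: "\<And>x. x \<in> space N \<Longrightarrow> src G (f x) = tgt G (h x)"
  shows "(\<lambda>x. gmul G (f x) (h x)) \<in> N \<rightarrow>\<^sub>M arrows G"
proof -
  obtain u v where u: "fibred_coding (objects G) (arrows G) (src G) u"
    and v: "fibred_coding (objects G) (arrows G) (tgt G) v"
    and m: "(\<lambda>(g, h). gmul G g h) \<in>
            fibred_product (objects G) (arrows G) (src G) u (arrows G) (tgt G) v \<rightarrow>\<^sub>M arrows G"
    using measurable_gmul by blast
  have um: "u \<in> arrows G \<rightarrow>\<^sub>M objects G \<Otimes>\<^sub>M count_space UNIV"
    and vm: "v \<in> arrows G \<rightarrow>\<^sub>M objects G \<Otimes>\<^sub>M count_space UNIV"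
    using u v unfolding fibred_coding_def by auto
  note [measurable] = um vm f h measurable_src
  have "(\<lambda>x. (f x, h x)) \<in> N \<rightarrow>\<^sub>M fibred_product (objects G) (arrows G) (src G) u (arrows G) (tgt G) v"
    unfolding fibred_product_def
  proof (rule measurable_vimage_algebra2)
    show "(\<lambda>x. (f x, h x)) \<in> space N \<rightarrow>
       {(a, b). a \<in> carrier G \<and> b \<in> carrier G \<and> src G a = tgt G b}"
      using eq measurable_space[OF f] measurable_space[OF h] by auto
    show "(\<lambda>x. case (f x, h x) of (a, b) \<Rightarrow> (src G a, snd (u a), snd (v b))) \<in>
       N \<rightarrow>\<^sub>M objects G \<Otimes>\<^sub>M count_space UNIV \<Otimes>\<^sub>M count_space UNIV"
      by simp
  qed
  from measurable_comp[OF this m] show ?thesis by (simp add: comp_def)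
qed

text \<open>The axioms give measurability of \<open>src\<close> into \<open>objects G\<close>;
  writing \<open>s(g) = g^{-1} g\<close> gives it into \<open>arrows G\<close>.\<close>

lemma measurable_src_arrows: "src G \<in> arrows G \<rightarrow>\<^sub>M arrows G"
proof -
  have "(\<lambda>g. gmul G (ginv G g) g) \<in> arrows G \<rightarrow>\<^sub>M arrows G"
    by (intro measurable_gmul_comp) (simp_all add: measurable_ginv src_inv)
  moreover have "(\<lambda>g. gmul G (ginv G g) g) \<in> arrows G \<rightarrow>\<^sub>M arrows G \<longleftrightarrow> src G \<in> arrows G \<rightarrow>\<^sub>M arrows G"
    by (intro measurable_cong inv_mul)
  ultimately show ?thesis by simp
qed

text \<open>The codings of \<open>g\<close> and \<open>s(g)\<close> have the same coordinate in
  \<open>X\<close>, so by injectivity \<open>g\<close> is a unit exactly when their integer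
  coordinates agree. Splitting by the common integer makes this a countable union of measurable
  sets.\<close>

lemma bisection_units: "bisection G (units G)"
proof -
  obtain u where u: "fibred_coding (objects G) (arrows G) (src G) u"
    using fibred_src unfolding countable_fibred_space_def by blast
  have um[measurable]: "u \<in> arrows G \<rightarrow>\<^sub>M objects G \<Otimes>\<^sub>M count_space UNIV"
    and inj: "inj_on u (carrier G)" and fst_u: "\<And>f. f \<in> carrier G \<Longrightarrow> fst (u f) = src G f"
    using u unfolding fibred_coding_def by auto
  note measurable_src_arrows[measurable]
  have src_car: "src G g \<in> carrier G" if "g \<in> carrier G" for g
    using that src_unit units_subset by blast
  define a where "a g = snd (u (src G g))" for g
  define b where "b g = snd (u g)" for g
  have [measurable]: "a \<in> arrows G \<rightarrow>\<^sub>M count_space UNIV" "b \<in> arrows G \<rightarrow>\<^sub>M count_space UNIV"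
    using measurable_compose[OF measurable_compose[OF measurable_src_arrows um] measurable_snd]
      measurable_compose[OF um measurable_snd] by (simp_all add: a_def[abs_def] b_def[abs_def])
  have "units G = {g \<in> space (arrows G). a g = b g}"
  proof (intro set_eqI iffI)
    fix g assume "g \<in> units G"
    then show "g \<in> {g \<in> space (arrows G). a g = b g}"
      using units_subset by (auto simp: src_of_unit a_def b_def)
  next
    fix g assume g: "g \<in> {g \<in> space (arrows G). a g = b g}"
    then have "fst (u (src G g)) = fst (u g)"
      using fst_u src_car src_unit src_of_unit by auto
    with g have "u (src G g) = u g" by (simp add: prod_eq_iff a_def b_def)
    with g inj src_car have "src G g = g" by (auto dest: inj_onD)
    with g show "g \<in> units G" using src_unit[of g] by auto
  qed
  also have "\<dots> = (\<Union>n. (a -` {n} \<inter> space (arrows G)) \<inter> (b -` {n} \<inter> space (arrows G)))"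
    by auto
  also have "\<dots> \<in> sets (arrows G)" by measurable
  finally show ?thesis
    unfolding bisection_def by (simp add: inj_on_def src_of_unit tgt_of_unit)
qed

lemma set_inv_vimage: "A \<subseteq> carrier G \<Longrightarrow> set_inv G A = ginv G -` A \<inter> carrier G"
proof
  assume A: "A \<subseteq> carrier G"
  then show "set_inv G A \<subseteq> ginv G -` A \<inter> carrier G"
    by (auto simp: set_inv_def inv_closed ginv_ginv subset_iff)
  show "ginv G -` A \<inter> carrier G \<subseteq> set_inv G A"
  proof
    fix g assume "g \<in> ginv G -` A \<inter> carrier G"
    then have "g = ginv G (ginv G g)" "ginv G g \<in> A" by (simp_all add: ginv_ginv)
    then show "g \<in> set_inv G A" unfolding set_inv_def by blast
  qed
qed

lemma bisection_set_inv:
  assumes \<phi>: "bisection G \<phi>" shows "bisection G (set_inv G \<phi>)"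
proof -
  have car: "\<phi> \<subseteq> carrier G" using \<phi> by (rule bisection_carrier)
  have "set_inv G \<phi> \<in> sets (arrows G)"
    unfolding set_inv_vimage[OF car]
    using \<phi> measurable_ginv by (auto simp: bisection_def intro: measurable_sets)
  moreover have "inj_on (src G) (set_inv G \<phi>)"
    using \<phi> car unfolding bisection_def inj_on_def set_inv_def
    by (auto simp: src_inv subset_iff)
  moreover have "inj_on (tgt G) (set_inv G \<phi>)"
    using \<phi> car unfolding bisection_def inj_on_def set_inv_def
    by (auto simp: tgt_inv subset_iff)
  ultimately show ?thesis by (simp add: bisection_def)
qed

text \<open>The sources of the inverses are the targets of \<open>\<phi>\<close>, and both images
  carry the measure of the bisection.\<close>

lemma emeasure_set_inv:
  assumes \<phi>: "bisection G \<phi>"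
  shows "emeasure (arrows G) (set_inv G \<phi>) = emeasure (arrows G) \<phi>"
proof -
  have car: "\<phi> \<subseteq> carrier G" using \<phi> by (rule bisection_carrier)
  have img: "src G ` set_inv G \<phi> = tgt G ` \<phi>"
    using car by (force simp: set_inv_def image_image src_inv intro: image_cong)
  have "emeasure (arrows G) (set_inv G \<phi>) = emeasure (objects G) (src G ` set_inv G \<phi>)"
    using bisection_set_inv[OF \<phi>] src_image(2) by (simp add: bisection_def)
  also have "\<dots> = emeasure (arrows G) \<phi>"
    unfolding img using \<phi> tgt_image(2) by (simp add: bisection_def)
  finally show ?thesis .
qed

lemma emeasure_bisection_le_1: "bisection G \<phi> \<Longrightarrow> emeasure (arrows G) \<phi> \<le> 1"
  using src_image(2)[of \<phi>] prob_space.emeasure_le_1[OF prob_objects, of "src G ` \<phi>"]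
  by (simp add: bisection_def)

text \<open>\<open>\<phi>A\<close> is the preimage of \<open>A\<close> under \<open>g \<mapsto> a\<^sup>-\<^sup>1g\<close>, where \<open>a\<close> is the element of \<open>\<phi>\<close> with target \<open>t(g)\<close>.\<close>

lemma sets_set_mul:
  assumes \<phi>: "bisection G \<phi>" and A: "A \<in> sets (arrows G)"
  shows "set_mul G \<phi> A \<in> sets (arrows G)"
proof -
  have car: "\<phi> \<subseteq> carrier G" "A \<subseteq> carrier G"
    using \<phi> A by (auto simp: bisection_carrier[THEN subsetD] dest: sets.sets_into_space)
  have inj: "inj_on (tgt G) \<phi>" and \<phi>s: "\<phi> \<in> sets (arrows G)"
    using \<phi> by (auto simp: bisection_def)
  define \<sigma> where "\<sigma> g = the_inv_into \<phi> (tgt G) (tgt G g)" for g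
  define T where "T = tgt G -` (tgt G ` \<phi>) \<inter> carrier G"
  have \<sigma>: "\<sigma> g \<in> \<phi>" "tgt G (\<sigma> g) = tgt G g" if "g \<in> T" for g
    using that inj unfolding T_def \<sigma>_def
    by (auto intro: the_inv_into_into f_the_inv_into_f)
  have \<sigma>_eq: "\<sigma> g = a" if "a \<in> \<phi>" "tgt G a = tgt G g" for a g
    using the_inv_into_f_f[OF inj that(1)] that(2) by (simp add: \<sigma>_def)
  have tgt_img: "tgt G ` B \<in> sets (objects G)" if "B \<in> sets (arrows G)" "B \<subseteq> \<phi>" for B
    using that inj by (intro tgt_image) (auto intro: inj_on_subset)
  have T: "T \<in> sets (arrows G)"
    unfolding T_def using measurable_tgt tgt_img[OF \<phi>s] by (auto intro: measurable_sets)
  have T_space: "space (restrict_space (arrows G) T) = T"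
    using T sets.sets_into_space by (auto simp: space_restrict_space)
  have \<sigma>_meas: "\<sigma> \<in> restrict_space (arrows G) T \<rightarrow>\<^sub>M arrows G"
  proof (rule measurableI)
    show "\<sigma> g \<in> carrier G" if "g \<in> space (restrict_space (arrows G) T)" for g
      using that \<sigma>(1)[of g] car T_space by auto
    fix B assume B: "B \<in> sets (arrows G)"
    \<comment> \<open>The section \<open>\<sigma>\<close> is measurable because its value lies in
      \<open>B\<close> exactly when the target lies in the measurable set
      \<open>t(\<phi> \<inter> B)\<close>.\<close>
    have "\<sigma> -` B \<inter> T = tgt G -` (tgt G ` (\<phi> \<inter> B)) \<inter> carrier G"
    proof (intro set_eqI iffI)
      fix g assume "g \<in> \<sigma> -` B \<inter> T"
      then show "g \<in> tgt G -` (tgt G ` (\<phi> \<inter> B)) \<inter> carrier G"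
        using \<sigma>[of g] by (auto simp: T_def intro!: image_eqI[of _ _ "\<sigma> g"])
    next
      fix g assume "g \<in> tgt G -` (tgt G ` (\<phi> \<inter> B)) \<inter> carrier G"
      then obtain a where "a \<in> \<phi>" "a \<in> B" "tgt G a = tgt G g" "g \<in> carrier G" by auto
      then show "g \<in> \<sigma> -` B \<inter> T"
        using \<sigma>_eq[of a g] by (auto simp: T_def intro!: image_eqI[of _ _ a])
    qed
    also have "\<dots> \<in> sets (arrows G)"
      using measurable_tgt tgt_img[of "\<phi> \<inter> B"] \<phi>s B by (auto intro: measurable_sets)
    finally show "\<sigma> -` B \<inter> space (restrict_space (arrows G) T) \<in> sets (restrict_space (arrows G) T)"
      using T_space T sets_restrict_space_iff[of T "arrows G"] sets.sets_into_space[OF T]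
      by (auto simp: Int_absorb1)
  qed
  define q where "q g = gmul G (ginv G (\<sigma> g)) g" for g
  have q_meas: "q \<in> restrict_space (arrows G) T \<rightarrow>\<^sub>M arrows G"
    unfolding q_def
  proof (rule measurable_gmul_comp)
    show "(\<lambda>g. ginv G (\<sigma> g)) \<in> restrict_space (arrows G) T \<rightarrow>\<^sub>M arrows G"
      using measurable_comp[OF \<sigma>_meas measurable_ginv] by (simp add: comp_def)
    show "(\<lambda>g. g) \<in> restrict_space (arrows G) T \<rightarrow>\<^sub>M arrows G"
      by (rule measurable_restrict_space1) simp
    show "src G (ginv G (\<sigma> g)) = tgt G g" if "g \<in> space (restrict_space (arrows G) T)" for g
      using that \<sigma>[of g] car T_space by (auto simp: src_inv)
  qed
  have "set_mul G \<phi> A = q -` A \<inter> T"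
  proof (intro set_eqI iffI)
    fix g assume "g \<in> set_mul G \<phi> A"
    then obtain a h where ah: "g = gmul G a h" "a \<in> \<phi>" "h \<in> A" "src G a = tgt G h"
      unfolding set_mul_def by blast
    have ah': "a \<in> carrier G" "h \<in> carrier G" using ah car by auto
    have t: "tgt G g = tgt G a" using ah ah' by (simp add: tgt_mul)
    have "\<sigma> g = a" using ah t by (intro \<sigma>_eq) simp_all
    then have "q g = h" using ah ah' by (simp add: q_def inv_mul_cancel)
    moreover have "g \<in> T"
      using ah ah' t unfolding T_def by (auto simp: mul_closed)
    ultimately show "g \<in> q -` A \<inter> T" using ah by simp
  next
    fix g assume g: "g \<in> q -` A \<inter> T"
    then have gc: "g \<in> carrier G" "\<sigma> g \<in> carrier G" "\<sigma> g \<in> \<phi>" "tgt G (\<sigma> g) = tgt G g"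
      using \<sigma>[of g] car by (auto simp: T_def)
    have "g = gmul G (\<sigma> g) (q g)"
      using gc unfolding q_def by (simp add: mul_inv_cancel)
    moreover have "src G (\<sigma> g) = tgt G (q g)"
      using gc unfolding q_def by (simp add: tgt_mul inv_closed src_inv tgt_inv)
    ultimately show "g \<in> set_mul G \<phi> A"
      using g gc unfolding set_mul_def by blast
  qed
  also have "\<dots> \<in> sets (arrows G)"
    using measurable_sets[OF q_meas A] T T_space sets_restrict_space_iff[of T "arrows G"]
      sets.sets_into_space[OF T] by (auto simp: Int_absorb1)
  finally show ?thesis .
qed

text \<open>A product \<open>a b\<close> has the source of \<open>b\<close> and the target of
  \<open>a\<close>, so either image of the product is contained in that of one factor. The resulting
  bounds make a product of bisections null when either factor is null.\<close>

lemma bisection_set_mul: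
  assumes \<phi>: "bisection G \<phi>" and \<psi>: "bisection G \<psi>"
  shows "bisection G (set_mul G \<phi> \<psi>)"
    and "emeasure (arrows G) (set_mul G \<phi> \<psi>) \<le> emeasure (arrows G) \<phi>"
    and "emeasure (arrows G) (set_mul G \<phi> \<psi>) \<le> emeasure (arrows G) \<psi>"
proof -
  have car: "\<phi> \<subseteq> carrier G" "\<psi> \<subseteq> carrier G"
    using \<phi> \<psi> by (auto simp: bisection_carrier[THEN subsetD])
  have s: "set_mul G \<phi> \<psi> \<in> sets (arrows G)"
    using \<phi> \<psi> by (intro sets_set_mul) (auto simp: bisection_def)
  have inj: "inj_on (src G) \<phi>" "inj_on (tgt G) \<phi>" "inj_on (src G) \<psi>" "inj_on (tgt G) \<psi>"
    using \<phi> \<psi> by (auto simp: bisection_def)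
  have inj_src: "inj_on (src G) (set_mul G \<phi> \<psi>)"
  proof (rule inj_onI)
    fix g g' assume "g \<in> set_mul G \<phi> \<psi>" "g' \<in> set_mul G \<phi> \<psi>" and eq: "src G g = src G g'"
    then obtain a b a' b' where ab: "g = gmul G a b" "a \<in> \<phi>" "b \<in> \<psi>" "src G a = tgt G b"
      "g' = gmul G a' b'" "a' \<in> \<phi>" "b' \<in> \<psi>" "src G a' = tgt G b'"
      unfolding set_mul_def by blast
    have "a \<in> carrier G" "b \<in> carrier G" "a' \<in> carrier G" "b' \<in> carrier G"
      using ab car by blast+
    then have "src G b = src G b'"
      using ab(4,8) eq src_mul[of a b] src_mul[of a' b'] unfolding ab(1,5) by simp
    then have "b = b'" using inj_onD[OF inj(3) _ ab(3,7)] by simp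
    moreover then have "a = a'" using inj_onD[OF inj(1) _ ab(2,6)] ab(4,8) by simp
    ultimately show "g = g'" using ab by simp
  qed
  have inj_tgt: "inj_on (tgt G) (set_mul G \<phi> \<psi>)"
  proof (rule inj_onI)
    fix g g' assume "g \<in> set_mul G \<phi> \<psi>" "g' \<in> set_mul G \<phi> \<psi>" and eq: "tgt G g = tgt G g'"
    then obtain a b a' b' where ab: "g = gmul G a b" "a \<in> \<phi>" "b \<in> \<psi>" "src G a = tgt G b"
      "g' = gmul G a' b'" "a' \<in> \<phi>" "b' \<in> \<psi>" "src G a' = tgt G b'"
      unfolding set_mul_def by blast
    have "a \<in> carrier G" "b \<in> carrier G" "a' \<in> carrier G" "b' \<in> carrier G"
      using ab car by blast+
    then have "tgt G a = tgt G a'"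
      using ab(4,8) eq tgt_mul[of a b] tgt_mul[of a' b'] unfolding ab(1,5) by simp
    then have "a = a'" using inj_onD[OF inj(2) _ ab(2,6)] by simp
    moreover then have "b = b'" using inj_onD[OF inj(4) _ ab(3,7)] ab(4,8) by simp
    ultimately show "g = g'" using ab by simp
  qed
  show "bisection G (set_mul G \<phi> \<psi>)"
    using s inj_src inj_tgt by (simp add: bisection_def)
  have sub: "src G ` set_mul G \<phi> \<psi> \<subseteq> src G ` \<psi>" "tgt G ` set_mul G \<phi> \<psi> \<subseteq> tgt G ` \<phi>"
    using car unfolding set_mul_def by (auto simp: src_mul tgt_mul subset_iff)
  have "emeasure (arrows G) (set_mul G \<phi> \<psi>) = emeasure (objects G) (src G ` set_mul G \<phi> \<psi>)"
    using src_image(2)[OF s inj_src] by simp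
  also have "\<dots> \<le> emeasure (objects G) (src G ` \<psi>)"
    using sub src_image(1) \<psi> inj by (intro emeasure_mono) (auto simp: bisection_def)
  also have "\<dots> = emeasure (arrows G) \<psi>"
    using src_image(2) \<psi> by (simp add: bisection_def)
  finally show "emeasure (arrows G) (set_mul G \<phi> \<psi>) \<le> emeasure (arrows G) \<psi>" .
  have "emeasure (arrows G) (set_mul G \<phi> \<psi>) = emeasure (objects G) (tgt G ` set_mul G \<phi> \<psi>)"
    using tgt_image(2)[OF s inj_tgt] by simp
  also have "\<dots> \<le> emeasure (objects G) (tgt G ` \<phi>)"
    using sub tgt_image(1) \<phi> inj by (intro emeasure_mono) (auto simp: bisection_def)
  also have "\<dots> = emeasure (arrows G) \<phi>"
    using tgt_image(2) \<phi> by (simp add: bisection_def)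
  finally show "emeasure (arrows G) (set_mul G \<phi> \<psi>) \<le> emeasure (arrows G) \<phi>" .
qed

lemma bisection_letter: "is_graphing G \<Phi> \<Longrightarrow> bisection G (letter G \<Phi> x)"
  by (simp add: letter_def case_prod_unfold is_graphing_bisection bisection_set_inv bisection_empty)

lemma bisection_code_word: "is_graphing G \<Phi> \<Longrightarrow> bisection G (code_word G \<Phi> c)"
  by (induction c) (simp_all add: bisection_units bisection_set_mul bisection_letter)

lemma sets_words_upto: "is_graphing G \<Phi> \<Longrightarrow> words_upto G \<Phi> k \<in> sets (arrows G)"
  unfolding words_upto_codes using bisection_code_word[of \<Phi>]
  by (intro sets.finite_UN finite_codes) (auto simp: bisection_def)

text \<open>Replacing letters by smaller ones that differ by null sets loses only products with a
  null factor, and these are null. Induction changes one letter at a time; finiteness of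
  \<open>codes k\<close> finishes.\<close>

lemma words_upto_Diff_null:
  assumes \<Psi>: "is_graphing G \<Psi>" and \<Psi>': "is_graphing G \<Psi>'" and idx: "idx \<Psi>' = idx \<Psi>"
    and sub: "\<And>i. i \<in> idx \<Psi> \<Longrightarrow> bis \<Psi>' i \<subseteq> bis \<Psi> i"
    and null: "\<And>i. i \<in> idx \<Psi> \<Longrightarrow> emeasure (arrows G) (bis \<Psi> i - bis \<Psi>' i) = 0"
  shows "emeasure (arrows G) (words_upto G \<Psi> k - words_upto G \<Psi>' k) = 0"
proof -
  note b = bisection_letter[OF \<Psi>] bisection_letter[OF \<Psi>'] bisection_code_word[OF \<Psi>] bisection_code_word[OF \<Psi>']
  note s = b[unfolded bisection_def, THEN conjunct1]
  have letter: "emeasure (arrows G) (letter G \<Psi> x - letter G \<Psi>' x) = 0" for x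
  proof -
    obtain i e where x: "x = (i, e)" by fastforce
    show ?thesis
    proof (cases "i \<in> idx \<Psi> \<and> e")
      case True
      then have i: "i \<in> idx \<Psi>" "i \<in> idx \<Psi>'" using idx by auto
      have B: "bisection G (bis \<Psi> i - bis \<Psi>' i)"
        using is_graphing_bisection[OF \<Psi> i(1)] is_graphing_bisection[OF \<Psi>' i(2)]
        by (intro bisection_Diff) (auto simp: bisection_def)
      have "letter G \<Psi> x - letter G \<Psi>' x \<subseteq> set_inv G (bis \<Psi> i - bis \<Psi>' i)"
        using True x i by (auto simp: letter_def set_inv_def)
      then have "emeasure (arrows G) (letter G \<Psi> x - letter G \<Psi>' x)
          \<le> emeasure (arrows G) (set_inv G (bis \<Psi> i - bis \<Psi>' i))"
        using bisection_set_inv[OF B] by (intro emeasure_mono) (auto simp: bisection_def)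
      also have "\<dots> = 0" using emeasure_set_inv[OF B] null i by simp
      finally show ?thesis by simp
    next
      case False
      then show ?thesis using x null idx by (auto simp: letter_def)
    qed
  qed
  have word: "emeasure (arrows G) (code_word G \<Psi> c - code_word G \<Psi>' c) = 0" for c
  proof (induction c)
    case (Cons x c)
    \<comment> \<open>A product lost in passing to the second word has lost its first factor, giving
      \<open>?A\<close>, or the remaining one, giving \<open>?B\<close>.\<close>
    let ?A = "set_mul G (letter G \<Psi> x - letter G \<Psi>' x) (code_word G \<Psi> c)"
    let ?B = "set_mul G (letter G \<Psi> x) (code_word G \<Psi> c - code_word G \<Psi>' c)"
    have 1: "bisection G (letter G \<Psi> x - letter G \<Psi>' x)" "bisection G (code_word G \<Psi> c - code_word G \<Psi>' c)"
      by (rule bisection_Diff[OF b(1) s(2)], rule bisection_Diff[OF b(3) s(4)])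
    have 2: "bisection G ?A" "bisection G ?B"
      by (rule bisection_set_mul(1)[OF 1(1) b(3)], rule bisection_set_mul(1)[OF b(1) 1(2)])
    have "emeasure (arrows G) ?A = 0" "emeasure (arrows G) ?B = 0"
      using bisection_set_mul(2)[OF 1(1) b(3)[of c]] letter[of x]
        bisection_set_mul(3)[OF b(1)[of x] 1(2)] Cons by auto
    then have "emeasure (arrows G) (?A \<union> ?B) \<le> 0"
      using 2 by (intro order_trans[OF emeasure_subadditive]) (auto simp: bisection_def)
    moreover have "code_word G \<Psi> (x # c) - code_word G \<Psi>' (x # c) \<subseteq> ?A \<union> ?B"
      by (auto simp: set_mul_def) blast
    then have "emeasure (arrows G) (code_word G \<Psi> (x # c) - code_word G \<Psi>' (x # c)) \<le> emeasure (arrows G) (?A \<union> ?B)"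
      using 2 by (intro emeasure_mono) (auto simp: bisection_def)
    ultimately show ?case by simp
  qed simp
  have "words_upto G \<Psi> k - words_upto G \<Psi>' k \<subseteq> (\<Union>c\<in>codes k. code_word G \<Psi> c - code_word G \<Psi>' c)"
    unfolding words_upto_codes by blast
  moreover have "(\<Union>c\<in>codes k. code_word G \<Psi> c - code_word G \<Psi>' c) \<in> null_sets (arrows G)"
    using word s by (intro null_sets.finite_UN finite_codes) (auto intro!: null_setsI)
  ultimately show ?thesis
    using sets_words_upto[OF \<Psi>] sets_words_upto[OF \<Psi>']
    by (meson null_setsD1 null_sets_subset sets.Diff)
qed

end

text \<open>Generation is demanded exactly, coarse inclusion only almost everywhere; countably many
  null bisections, adjoined at no cost, bridge the gap. The setting \<open>groupoid_laws\<close>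
  covers both single groupoids and the ultraproduct.\<close>

lemma groupoid_cost_le_add_null:
  fixes N :: "nat \<Rightarrow> 'a set"
  assumes laws: "groupoid_laws G" and \<Psi>: "is_graphing G \<Psi>"
    and N: "\<And>k. bisection G (N k)" "\<And>k. emeasure (arrows G) (N k) = 0"
    and gen: "\<And>H. subgroupoid G H \<Longrightarrow> (\<And>i. i \<in> idx \<Psi> \<Longrightarrow> bis \<Psi> i \<subseteq> H) \<Longrightarrow> (\<And>k. N k \<subseteq> H)
      \<Longrightarrow> carrier G \<subseteq> H"
  shows "groupoid_cost G \<le> graphing_cost G \<Psi>"
proof -
  interpret groupoid_laws G by (rule laws)
  \<comment> \<open>Members of \<open>\<Psi>\<close> go to the even indices \<open>2 i\<close>, null
    bisections to the odd indices \<open>2 k + 1\<close>, and empty sets fill the gaps.\<close>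
  define \<Theta> where "\<Theta> = \<lparr>idx = {1..}, bis = (\<lambda>j. if even j then
     (if j div 2 \<in> idx \<Psi> then bis \<Psi> (j div 2) else {}) else N (j div 2))\<rparr>"
  have \<Theta>: "is_graphing G \<Theta>"
    using N(1) is_graphing_bisection[OF \<Psi>] by (auto simp: is_graphing_def \<Theta>_def bisection_empty)
  have "generating G \<Theta>"
    unfolding generating_def
  proof (rule hull_unique)
    show "(\<Union>i\<in>idx \<Theta>. bis \<Theta> i) \<subseteq> carrier G"
      using is_graphing_carrier[OF \<Theta>] by blast
    show "subgroupoid G (carrier G)"
      by (simp add: subgroupoid_def units_subset inv_closed mul_closed)
    fix H assume H: "(\<Union>i\<in>idx \<Theta>. bis \<Theta> i) \<subseteq> H" "subgroupoid G H"
    have sub: "bis \<Theta> j \<subseteq> H" if "j \<ge> 1" for j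
      using H(1) that by (auto simp: \<Theta>_def)
    show "carrier G \<subseteq> H"
    proof (rule gen[OF H(2)])
      show "bis \<Psi> i \<subseteq> H" if "i \<in> idx \<Psi>" for i
        using sub[of "2 * i"] that is_graphing_idx[OF \<Psi> that] by (simp add: \<Theta>_def)
      show "N k \<subseteq> H" for k
        using sub[of "2 * k + 1"] by (simp add: \<Theta>_def)
    qed
  qed
  then have "groupoid_cost G \<le> graphing_cost G \<Theta>"
    unfolding groupoid_cost_def using \<Theta> by (intro Inf_lower) blast
  \<comment> \<open>Only even indices coming from \<open>idx \<Psi>\<close> contribute; all others
    carry null or empty sets.\<close>
  also have "graphing_cost G \<Theta> = (\<Sum>\<^sub>\<infinity>j\<in>(*) 2 ` idx \<Psi>. emeasure (arrows G) (bis \<Theta> j))"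
    unfolding graphing_cost_def
  proof (rule infsum_cong_neutral)
    fix j assume "j \<in> idx \<Theta> - (*) 2 ` idx \<Psi>"
    then show "emeasure (arrows G) (bis \<Theta> j) = 0"
      using N(2) by (auto simp: \<Theta>_def)
  qed (use is_graphing_idx[OF \<Psi>] in \<open>force simp: \<Theta>_def\<close>)+
  also have "\<dots> = graphing_cost G \<Psi>"
    unfolding graphing_cost_def
    by (subst infsum_reindex) (auto simp: inj_on_def comp_def \<Theta>_def intro!: infsum_cong)
  finally show ?thesis .
qed

section \<open>Coarse inclusion and cost in a single groupoid\<close>

context pmp_groupoid
begin

lemma coarse_le_iff:
  assumes \<Psi>: "is_graphing G \<Psi>" and \<Phi>: "is_graphing G \<Phi>"
  shows "coarse_le G M \<Psi> \<Phi> \<longleftrightarrow>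
    (\<forall>k\<in>idx \<Psi>. emeasure (arrows G) (bis \<Psi> k - words_upto G \<Phi> (M k)) = 0)"
  unfolding coarse_le_def
proof (rule ball_cong[OF refl])
  fix k assume "k \<in> idx \<Psi>"
  then have s: "bis \<Psi> k - words_upto G \<Phi> (M k) \<in> sets (arrows G)"
    using is_graphing_bisection[OF \<Psi>] sets_words_upto[OF \<Phi>] by (auto simp: bisection_def)
  have "{g \<in> carrier G. \<not> (g \<in> bis \<Psi> k \<longrightarrow> g \<in> words_upto G \<Phi> (M k))} = bis \<Psi> k - words_upto G \<Phi> (M k)"
    using is_graphing_carrier[OF \<Psi> \<open>k \<in> idx \<Psi>\<close>] by auto
  then show "(AE g in arrows G. g \<in> bis \<Psi> k \<longrightarrow> g \<in> words_upto G \<Phi> (M k)) \<longleftrightarrow>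
      emeasure (arrows G) (bis \<Psi> k - words_upto G \<Phi> (M k)) = 0"
    using s by (subst AE_iff_measurable[OF s]) auto
qed

text \<open>If \<open>\<Phi>\<close> is coarsely contained in \<open>\<Psi>\<close>, the part of
  each member of \<open>\<Phi>\<close> missed by words in \<open>\<Psi>\<close> is a null bisection.
  Adjoining these parts to \<open>\<Psi>\<close> recovers \<open>\<Phi>\<close>, hence the whole
  groupoid.\<close>

lemma groupoid_cost_le_coarse_cost:
  assumes \<Phi>: "is_graphing G \<Phi>" "generating G \<Phi>"
  shows "groupoid_cost G \<le> coarse_cost M G \<Phi>"
  unfolding coarse_cost_def
proof (rule Inf_greatest)
  fix x assume "x \<in> {graphing_cost G \<Psi> |\<Psi>. is_graphing G \<Psi> \<and> coarse_equiv G M \<Psi> \<Phi>}"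
  then obtain \<Psi> where x: "x = graphing_cost G \<Psi>" and \<Psi>: "is_graphing G \<Psi>"
    and "coarse_le G M \<Phi> \<Psi>" unfolding coarse_equiv_def by blast
  then have null: "\<And>k. k \<in> idx \<Phi> \<Longrightarrow> emeasure (arrows G) (bis \<Phi> k - words_upto G \<Psi> (M k)) = 0"
    using coarse_le_iff[OF \<Phi>(1) \<Psi>] by blast
  define N where "N k = (if k \<in> idx \<Phi> then bis \<Phi> k - words_upto G \<Psi> (M k) else {})" for k
  have "groupoid_cost G \<le> graphing_cost G \<Psi>"
  proof (rule groupoid_cost_le_add_null[OF groupoid_laws_axioms \<Psi>])
    show "bisection G (N k)" "emeasure (arrows G) (N k) = 0" for k
      using is_graphing_bisection[OF \<Phi>(1)] sets_words_upto[OF \<Psi>] null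
      by (auto simp: N_def bisection_empty intro: bisection_Diff)
    fix H assume H: "subgroupoid G H" "\<And>i. i \<in> idx \<Psi> \<Longrightarrow> bis \<Psi> i \<subseteq> H" "\<And>k. N k \<subseteq> H"
    have "bis \<Phi> k \<subseteq> H" if "k \<in> idx \<Phi>" for k
      using H(3)[of k] that words_upto_subset_subgroupoid[OF is_graphing_carrier[OF \<Psi>] H(1,2), of "M k"]
      by (auto simp: N_def)
    then have "subgroupoid G hull (\<Union>i\<in>idx \<Phi>. bis \<Phi> i) \<subseteq> H"
      using H(1) by (intro hull_minimal) auto
    then show "carrier G \<subseteq> H" using \<Phi>(2) by (simp add: generating_def)
  qed
  then show "groupoid_cost G \<le> x" by (simp add: x)
qed

end


section \<open>Internal sets and saturation\<close>

locale ultra =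
  fixes U :: "nat filter"
  assumes U: "nonprincipal_ultrafilter U"
begin

lemma nontrivial: "U \<noteq> bot"
  using U by (simp add: nonprincipal_ultrafilter_def)

lemma ev_not: "(\<forall>\<^sub>F n in U. \<not> P n) \<longleftrightarrow> \<not> (\<forall>\<^sub>F n in U. P n)"
proof
  assume "\<forall>\<^sub>F n in U. \<not> P n"
  then show "\<not> (\<forall>\<^sub>F n in U. P n)"
    using nontrivial eventually_conj[of "\<lambda>n. \<not> P n" U P] by (auto simp: trivial_limit_def)
qed (use U in \<open>auto simp: nonprincipal_ultrafilter_def\<close>)

lemma ev_disj: "(\<forall>\<^sub>F n in U. P n \<or> Q n) \<longleftrightarrow> (\<forall>\<^sub>F n in U. P n) \<or> (\<forall>\<^sub>F n in U. Q n)"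
  using ev_not[of "\<lambda>n. P n \<or> Q n"] ev_not[of P] ev_not[of Q] by (auto simp: eventually_conj_iff)

lemma ev_const: "(\<forall>\<^sub>F n in U. P) \<longleftrightarrow> P"
  using nontrivial by (simp add: eventually_const)

text \<open>By nonprincipality each single point may be discarded, hence each finite initial
  segment.\<close>

lemma ev_ge: "\<forall>\<^sub>F n in U. k \<le> n"
proof (induction k)
  case (Suc k)
  have "\<forall>\<^sub>F n in U. n \<noteq> k"
    using U unfolding nonprincipal_ultrafilter_def ev_not by blast
  with Suc show ?case by eventually_elim simp
qed simp

text \<open>Take for \<open>f n\<close> the largest \<open>k \<le> n\<close> with
  \<open>P k n\<close>. For fixed \<open>k\<close>, both \<open>k \<le> n\<close> and
  \<open>P k n\<close> hold for almost all \<open>n\<close>, so \<open>f\<close> tends to infinity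
  along \<open>U\<close>.\<close>

lemma diagonal:
  fixes P :: "nat \<Rightarrow> nat \<Rightarrow> bool"
  assumes "\<And>k. \<forall>\<^sub>F n in U. P k n"
  shows "\<exists>f. \<forall>k. \<forall>\<^sub>F n in U. k \<le> f n \<and> P (f n) n"
proof -
  \<comment> \<open>The cap \<open>k \<le> n\<close> makes the set finite and the default 0 makes it
    nonempty; \<open>P 0 n\<close> is invoked below in case the maximum is this default.\<close>
  define f where "f n = Max (insert 0 {k. k \<le> n \<and> P k n})" for n
  have "\<forall>\<^sub>F n in U. k \<le> f n \<and> P (f n) n" for k
    using ev_ge[of k] assms[of k] assms[of 0]
  proof eventually_elim
    case (elim n)
    let ?S = "insert 0 {k. k \<le> n \<and> P k n}"
    have fin: "finite ?S" by (rule finite_subset[of _ "{..n}"]) auto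
    then have "f n \<in> ?S" unfolding f_def by (intro Max_in) auto
    moreover have "k \<le> f n" unfolding f_def using fin elim by (intro Max_ge) auto
    ultimately show ?case using elim by auto
  qed
  then show ?thesis by blast
qed

lemma ultra_class_eq_iff: "ultra_class U x = ultra_class U y \<longleftrightarrow> (\<forall>\<^sub>F n in U. x n = y n)"
  using mem_ultra_class[of y U x] mem_ultra_class[of y U y] ultra_class_eqI by auto

lemma ultra_set_eq: "ultra_set U A = {ultra_class U x | x. \<forall>\<^sub>F n in U. x n \<in> A n}"
  by (auto simp: ultra_set_def quotient_def ultra_class_def)

lemma ultra_setE:
  assumes "c \<in> ultra_set U A"
  obtains x where "c = ultra_class U x" "\<forall>\<^sub>F n in U. x n \<in> A n"
  using assms by (auto simp: ultra_set_eq)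

lemma mem_ultra_set: "ultra_class U x \<in> ultra_set U A \<longleftrightarrow> (\<forall>\<^sub>F n in U. x n \<in> A n)"
proof
  assume "ultra_class U x \<in> ultra_set U A"
  then obtain y where "\<forall>\<^sub>F n in U. x n = y n" "\<forall>\<^sub>F n in U. y n \<in> A n"
    by (auto simp: ultra_set_eq ultra_class_eq_iff)
  then show "\<forall>\<^sub>F n in U. x n \<in> A n" by eventually_elim simp
qed (auto simp: ultra_set_eq)

lemma ultra_set_cases:
  assumes "\<And>x. (\<forall>\<^sub>F n in U. x n \<in> A n) \<Longrightarrow> ultra_class U x \<in> S"
  shows "ultra_set U A \<subseteq> S"
  using assms by (auto simp: ultra_set_eq)

text \<open>Membership in \<open>ultra_set\<close> is an almost-everywhere condition; resetting the
  exceptional coordinates gives a representative that satisfies it for every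
  \<open>n\<close>.\<close>

lemma ultra_set_choose:
  assumes "\<And>n. S n \<noteq> {}" "c \<in> ultra_set U S"
  obtains x where "c = ultra_class U x" "\<And>n. x n \<in> S n"
proof -
  obtain y where y: "c = ultra_class U y" "\<forall>\<^sub>F n in U. y n \<in> S n"
    using assms(2) by (rule ultra_setE)
  define x where "x n = (if y n \<in> S n then y n else (SOME z. z \<in> S n))" for n
  have "x n \<in> S n" for n
    using assms(1)[of n] by (auto simp: x_def some_in_eq)
  moreover have "c = ultra_class U x"
    using y unfolding y(1) ultra_class_eq_iff by (auto elim: eventually_mono simp: x_def)
  ultimately show ?thesis by (rule that[rotated])
qed

text \<open>If the inclusion is not almost everywhere, then by the ultrafilter property it fails
  almost everywhere, and points chosen in \<open>A n - B n\<close> give a class in the first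
  internal set but not in the second.\<close>

lemma ultra_set_subset_iff: "ultra_set U A \<subseteq> ultra_set U B \<longleftrightarrow> (\<forall>\<^sub>F n in U. A n \<subseteq> B n)"
proof
  assume sub: "ultra_set U A \<subseteq> ultra_set U B"
  show "\<forall>\<^sub>F n in U. A n \<subseteq> B n"
  proof (rule ccontr)
    assume "\<not> (\<forall>\<^sub>F n in U. A n \<subseteq> B n)"
    then have *: "\<forall>\<^sub>F n in U. \<not> A n \<subseteq> B n" by (simp add: ev_not)
    define x where "x n = (SOME z. z \<in> A n - B n)" for n
    have x: "\<forall>\<^sub>F n in U. x n \<in> A n - B n"
      using * by eventually_elim (metis x_def someI_ex Diff_iff subsetI)
    then have "\<forall>\<^sub>F n in U. x n \<in> A n" by eventually_elim simp
    then have "\<forall>\<^sub>F n in U. x n \<in> B n"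
      using sub by (auto simp: subset_iff simp flip: mem_ultra_set)
    with x have "\<forall>\<^sub>F n in U. False" by eventually_elim simp
    then show False by (simp add: ev_const)
  qed
next
  assume sub: "\<forall>\<^sub>F n in U. A n \<subseteq> B n"
  show "ultra_set U A \<subseteq> ultra_set U B"
  proof (rule ultra_set_cases)
    fix x assume "\<forall>\<^sub>F n in U. x n \<in> A n"
    with sub show "ultra_class U x \<in> ultra_set U B"
      unfolding mem_ultra_set by eventually_elim blast
  qed
qed

lemma ultra_set_eq_iff: "ultra_set U A = ultra_set U B \<longleftrightarrow> (\<forall>\<^sub>F n in U. A n = B n)"
  unfolding set_eq_subset ultra_set_subset_iff by (simp add: eventually_conj_iff)

lemma ultra_set_mono: "(\<And>n. A n \<subseteq> B n) \<Longrightarrow> ultra_set U A \<subseteq> ultra_set U B"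
  by (simp add: ultra_set_subset_iff)

lemma ultra_set_empty: "ultra_set U (\<lambda>n. {}) = {}"
  by (auto simp: ultra_set_eq ev_const)

lemma ultra_set_empty_iff: "ultra_set U A = {} \<longleftrightarrow> (\<forall>\<^sub>F n in U. A n = {})"
  using ultra_set_eq_iff[of A "\<lambda>n. {}"] by (simp add: ultra_set_empty)

lemma ultra_set_Int: "ultra_set U (\<lambda>n. A n \<inter> B n) = ultra_set U A \<inter> ultra_set U B"
proof
  show "ultra_set U A \<inter> ultra_set U B \<subseteq> ultra_set U (\<lambda>n. A n \<inter> B n)"
  proof safe
    fix c assume "c \<in> ultra_set U A" and c: "c \<in> ultra_set U B"
    then obtain x where "c = ultra_class U x" "\<forall>\<^sub>F n in U. x n \<in> A n" by (elim ultra_setE) blast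
    with c show "c \<in> ultra_set U (\<lambda>n. A n \<inter> B n)"
      by (simp add: mem_ultra_set eventually_conj_iff)
  qed
qed (auto simp: ultra_set_subset_iff)

lemma ultra_set_Un: "ultra_set U (\<lambda>n. A n \<union> B n) = ultra_set U A \<union> ultra_set U B"
proof
  show "ultra_set U (\<lambda>n. A n \<union> B n) \<subseteq> ultra_set U A \<union> ultra_set U B"
    by (rule ultra_set_cases) (simp add: mem_ultra_set ev_disj)
qed (auto simp: ultra_set_subset_iff)

lemma ultra_set_Diff: "ultra_set U (\<lambda>n. A n - B n) = ultra_set U A - ultra_set U B"
proof
  show "ultra_set U (\<lambda>n. A n - B n) \<subseteq> ultra_set U A - ultra_set U B"
    by (rule ultra_set_cases) (simp add: mem_ultra_set eventually_conj_iff ev_not)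
  show "ultra_set U A - ultra_set U B \<subseteq> ultra_set U (\<lambda>n. A n - B n)"
  proof
    fix c assume "c \<in> ultra_set U A - ultra_set U B"
    then obtain x where "c = ultra_class U x" "\<forall>\<^sub>F n in U. x n \<in> A n" "c \<notin> ultra_set U B"
      by (auto elim: ultra_setE)
    then show "c \<in> ultra_set U (\<lambda>n. A n - B n)"
      by (simp add: mem_ultra_set eventually_conj_iff ev_not)
  qed
qed

lemma ultra_set_UN:
  assumes "finite I"
  shows "ultra_set U (\<lambda>n. \<Union>i\<in>I. A i n) = (\<Union>i\<in>I. ultra_set U (A i))"
  using assms by induction (simp_all add: ultra_set_empty ultra_set_Un)

text \<open>If no finite union suffices, diagonalisation gives \<open>f n\<close> tending to
  infinity and points of \<open>A n\<close> outside the first \<open>f n\<close> sets. Their class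
  lies in the internal set of \<open>A\<close> but in none of the covering ones.\<close>

lemma saturation:
  assumes "ultra_set U A \<subseteq> (\<Union>i::nat. ultra_set U (B i))"
  shows "\<exists>N. \<forall>\<^sub>F n in U. A n \<subseteq> (\<Union>i<N. B i n)"
proof (rule ccontr)
  assume "\<nexists>N. \<forall>\<^sub>F n in U. A n \<subseteq> (\<Union>i<N. B i n)"
  then have "\<forall>\<^sub>F n in U. \<not> A n \<subseteq> (\<Union>i<N. B i n)" for N
    by (simp add: ev_not)
  then obtain f where f: "\<And>k. \<forall>\<^sub>F n in U. k \<le> f n \<and> \<not> A n \<subseteq> (\<Union>i<f n. B i n)"
    using diagonal[of "\<lambda>N n. \<not> A n \<subseteq> (\<Union>i<N. B i n)"] by blast
  define x where "x n = (SOME z. z \<in> A n - (\<Union>i<f n. B i n))" for n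
  have x: "\<forall>\<^sub>F n in U. k \<le> f n \<and> x n \<in> A n - (\<Union>i<f n. B i n)" for k
    using f[of k]
  proof eventually_elim
    case (elim n)
    then have "\<exists>z. z \<in> A n - (\<Union>i<f n. B i n)" by blast
    then have "x n \<in> A n - (\<Union>i<f n. B i n)" unfolding x_def by (rule someI_ex)
    with elim show ?case by blast
  qed
  have "ultra_class U x \<in> ultra_set U A"
    unfolding mem_ultra_set using x[of 0] by eventually_elim blast
  then obtain i where "ultra_class U x \<in> ultra_set U (B i)" using assms by blast
  then have "\<forall>\<^sub>F n in U. x n \<in> B i n" by (simp add: mem_ultra_set)
  with x[of "Suc i"] have "\<forall>\<^sub>F n in U. False"
    by eventually_elim auto
  then show False by (simp add: ev_const)
qed

lemma quotient_ultra_eq: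
  assumes "\<And>n. S n \<noteq> {}"
  shows "{x. \<forall>n. x n \<in> S n} // ultra_eq U = ultra_set U S"
proof
  show "{x. \<forall>n. x n \<in> S n} // ultra_eq U \<subseteq> ultra_set U S"
    by (auto simp: ultra_set_eq quotient_def ultra_class_def)
  show "ultra_set U S \<subseteq> {x. \<forall>n. x n \<in> S n} // ultra_eq U"
  proof
    fix c assume "c \<in> ultra_set U S"
    then obtain x where "c = ultra_class U x" "\<And>n. x n \<in> S n"
      using ultra_set_choose[of S c] assms by blast
    then show "c \<in> {x. \<forall>n. x n \<in> S n} // ultra_eq U"
      by (auto simp: quotient_def ultra_class_def)
  qed
qed

end

section \<open>The algebraic structure of the ultraproduct\<close>

locale graphed_groupoid_seq = ultra U for U +
  fixes G :: "nat \<Rightarrow> 'a groupoid" and \<Phi> :: "nat \<Rightarrow> 'a graphing"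
  assumes graphed: "\<And>n. pmp_graphed_groupoid (G n) (\<Phi> n)"
begin

sublocale P: pmp_groupoid "G n" for n
  using graphed[of n] by (simp add: pmp_graphed_groupoid_def)

lemma is_graphing_\<Phi>: "is_graphing (G n) (\<Phi> n)" and generating_\<Phi>: "generating (G n) (\<Phi> n)"
  using graphed[of n] by (simp_all add: pmp_graphed_groupoid_def)

abbreviation "GU \<equiv> ultra_groupoid U G \<Phi>"

abbreviation "wball K n \<equiv> words_upto (G n) (\<Phi> n) K"

lemma GU_sel: "objects GU = ultra_objects U G" "arrows GU = ultra_arrows U G \<Phi>"
  "src GU = ultra_map U (\<lambda>n. src (G n))" "tgt GU = ultra_map U (\<lambda>n. tgt (G n))"
  "gmul GU = ultra_map2 U (\<lambda>n. gmul (G n))" "ginv GU = ultra_map U (\<lambda>n. ginv (G n))"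
  by (simp_all add: ultra_groupoid_def)

lemma GU_class:
  "src GU (ultra_class U x) = ultra_class U (\<lambda>n. src (G n) (x n))"
  "tgt GU (ultra_class U x) = ultra_class U (\<lambda>n. tgt (G n) (x n))"
  "gmul GU (ultra_class U x) (ultra_class U y) = ultra_class U (\<lambda>n. gmul (G n) (x n) (y n))"
  "ginv GU (ultra_class U x) = ultra_class U (\<lambda>n. ginv (G n) (x n))"
  by (simp_all add: GU_sel ultra_map_class ultra_map2_class)

lemma units_nonempty: "units (G n) \<noteq> {}"
  by (rule prob_space.not_empty[OF P.prob_objects])

lemma wball_nonempty: "wball K n \<noteq> {}"
  using units_nonempty[of n] units_subset_words_upto[of "G n" "\<Phi> n" K] by blast

lemma wball_carrier: "wball K n \<subseteq> carrier (G n)"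
  by (rule P.words_upto_carrier[OF is_graphing_carrier[OF is_graphing_\<Phi>]])

lemma glength_le_iff_wball: "g \<in> carrier (G n) \<Longrightarrow> glength (G n) (\<Phi> n) g \<le> K \<longleftrightarrow> g \<in> wball K n"
  by (rule P.glength_le_iff[OF is_graphing_carrier[OF is_graphing_\<Phi>] generating_\<Phi>])

lemma sets_wball: "wball K n \<in> sets (arrows (G n))"
  by (rule P.sets_words_upto[OF is_graphing_\<Phi>])

definition bounded_seqs :: "(nat \<Rightarrow> 'a set) set" where
  "bounded_seqs = {E. (\<forall>n. E n \<in> sets (arrows (G n))) \<and> (\<exists>K. \<forall>n. E n \<subseteq> wball K n)}"

lemma bounded_seqs_alt:
  "{E. (\<forall>n. E n \<in> sets (arrows (G n))) \<and> (\<exists>K. \<forall>n. \<forall>g\<in>E n. glength (G n) (\<Phi> n) g \<le> K)} = bounded_seqs"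
proof -
  have "(\<forall>g\<in>E n. glength (G n) (\<Phi> n) g \<le> K) \<longleftrightarrow> E n \<subseteq> wball K n" if "E n \<in> sets (arrows (G n))" for E n K
    using sets.sets_into_space[OF that] glength_le_iff_wball by blast
  then show ?thesis unfolding bounded_seqs_def by (intro Collect_cong) blast
qed

text \<open>A uniform length bound means membership in one ball \<open>wball K\<close> for all
  \<open>n\<close>, so the carrier becomes a countable union of internal sets. The balls contain the
  units and are therefore nonempty, as the choice of representatives demands.\<close>

lemma bounded_arrow_quotient:
  "{g. (\<forall>n. g n \<in> carrier (G n)) \<and> (\<exists>K. \<forall>n. glength (G n) (\<Phi> n) (g n) \<le> K)} // ultra_eq U
    = (\<Union>K. ultra_set U (wball K))"
proof -
  have "{g. (\<forall>n. g n \<in> carrier (G n)) \<and> (\<exists>K. \<forall>n. glength (G n) (\<Phi> n) (g n) \<le> K)}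
      = (\<Union>K. {g. \<forall>n. g n \<in> wball K n})" (is "?L = ?R")
  proof (intro set_eqI iffI)
    fix g assume "g \<in> ?L"
    then obtain K where "\<And>n. g n \<in> carrier (G n)" "\<And>n. glength (G n) (\<Phi> n) (g n) \<le> K" by blast
    then have "\<forall>n. g n \<in> wball K n" by (simp flip: glength_le_iff_wball)
    then show "g \<in> ?R" by blast
  next
    fix g assume "g \<in> ?R"
    then obtain K where K: "\<And>n. g n \<in> wball K n" by blast
    then have "\<And>n. g n \<in> carrier (G n)" using wball_carrier by blast
    with K have "(\<forall>n. g n \<in> carrier (G n)) \<and> (\<forall>n. glength (G n) (\<Phi> n) (g n) \<le> K)"
      by (simp add: glength_le_iff_wball)
    then show "g \<in> ?L" by blast
  qed
  moreover have "(\<Union>K. {g. \<forall>n. g n \<in> wball K n}) // ultra_eq U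
      = (\<Union>K. {g. \<forall>n. g n \<in> wball K n} // ultra_eq U)"
    unfolding quotient_def by (simp only: UN_simps)
  moreover have "{g. \<forall>n. g n \<in> wball K n} // ultra_eq U = ultra_set U (wball K)" for K
    by (rule quotient_ultra_eq[OF wball_nonempty])
  ultimately show ?thesis by simp
qed

lemma ultra_set_bounded_subset: "ultra_set U ` bounded_seqs \<subseteq> Pow (\<Union>K. ultra_set U (wball K))"
proof safe
  fix E c assume E: "E \<in> bounded_seqs" and c: "c \<in> ultra_set U E"
  then obtain K where "\<And>n. E n \<subseteq> wball K n" by (auto simp: bounded_seqs_def)
  then have "ultra_set U E \<subseteq> ultra_set U (wball K)" by (rule ultra_set_mono)
  with c show "c \<in> (\<Union>K. ultra_set U (wball K))" by blast
qed

lemma ultra_arrows_eq: "ultra_arrows U G \<Phi> =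
    completion (extend_measure (\<Union>K. ultra_set U (wball K)) bounded_seqs (ultra_set U)
      (\<lambda>A. Lim U (\<lambda>n. emeasure (arrows (G n)) (A n))))"
  unfolding ultra_arrows_def loeb_measure_def bounded_seqs_alt bounded_arrow_quotient ..

lemma carrier_GU: "carrier GU = (\<Union>K. ultra_set U (wball K))"
  using ultra_set_bounded_subset by (simp add: GU_sel ultra_arrows_eq space_extend_measure)

lemma units_GU: "units GU = ultra_set U (\<lambda>n. units (G n))"
proof -
  have "ultra_set U ` {A. \<forall>n. A n \<in> sets (objects (G n))} \<subseteq> Pow (ultra_set U (\<lambda>n. units (G n)))"
  proof safe
    fix A c assume "\<forall>n. A n \<in> sets (objects (G n))" and c: "c \<in> ultra_set U A"
    then have "ultra_set U A \<subseteq> ultra_set U (\<lambda>n. units (G n))"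
      by (intro ultra_set_mono sets.sets_into_space) simp
    with c show "c \<in> ultra_set U (\<lambda>n. units (G n))" by blast
  qed
  then show ?thesis
    by (simp add: GU_sel ultra_objects_def loeb_measure_def
        quotient_ultra_eq[OF units_nonempty] space_extend_measure)
qed

lemma GU_carrierE:
  assumes "c \<in> carrier GU"
  obtains x K where "c = ultra_class U x" "\<And>n. x n \<in> wball K n" "\<And>n. x n \<in> carrier (G n)"
proof -
  obtain K where "c \<in> ultra_set U (wball K)" using assms by (auto simp: carrier_GU)
  then obtain x where "c = ultra_class U x" "\<And>n. x n \<in> wball K n"
    using ultra_set_choose[of "wball K" c] wball_nonempty by blast
  with wball_carrier show ?thesis by (intro that) auto
qed

lemma GU_unitsE:
  assumes "c \<in> units GU"
  obtains x where "c = ultra_class U x" "\<And>n. x n \<in> units (G n)"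
  using assms ultra_set_choose[of "\<lambda>n. units (G n)" c] units_nonempty unfolding units_GU by blast

lemma GU_carrierI: "\<forall>\<^sub>F n in U. x n \<in> wball K n \<Longrightarrow> ultra_class U x \<in> carrier GU"
  unfolding carrier_GU using mem_ultra_set by blast

text \<open>Representatives can be chosen as arrows for every \<open>n\<close>, whereas
  composability holds only for almost all \<open>n\<close>. Bounded length survives because word
  levels add under products and are kept by inverses.\<close>

lemma GU_groupoid_laws: "groupoid_laws GU"
proof
  show "units GU \<subseteq> carrier GU"
  proof -
    have "ultra_set U (\<lambda>n. units (G n)) \<subseteq> ultra_set U (wball 0)"
      by (intro ultra_set_mono units_subset_words_upto)
    then show ?thesis unfolding carrier_GU units_GU by blast
  qed
next
  fix g assume "g \<in> carrier GU"
  then obtain x K where x: "g = ultra_class U x" "\<And>n. x n \<in> wball K n" "\<And>n. x n \<in> carrier (G n)"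
    by (rule GU_carrierE) blast
  note [simp] = x(3) P.src_unit P.tgt_unit P.mul_src P.tgt_mul_self P.src_inv P.tgt_inv P.mul_inv P.inv_mul
  show "src GU g \<in> units GU" "tgt GU g \<in> units GU"
    by (simp_all add: x(1) units_GU GU_class mem_ultra_set)
  show "gmul GU g (src GU g) = g" "gmul GU (tgt GU g) g = g" "src GU (ginv GU g) = tgt GU g"
     "tgt GU (ginv GU g) = src GU g" "gmul GU g (ginv GU g) = tgt GU g" "gmul GU (ginv GU g) g = src GU g"
    by (simp_all add: x(1) GU_class)
  show "ginv GU g \<in> carrier GU"
    unfolding x(1) GU_class
    using P.words_upto_ginv[OF is_graphing_carrier[OF is_graphing_\<Phi>] x(2)]
    by (intro GU_carrierI[where K = K]) simp
next
  fix c assume "c \<in> units GU"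
  then obtain x where "c = ultra_class U x" "\<And>n. x n \<in> units (G n)" by (rule GU_unitsE) blast
  then show "src GU c = c" "tgt GU c = c"
    by (simp_all add: GU_class P.src_of_unit P.tgt_of_unit)
next
  fix g h assume "g \<in> carrier GU" "h \<in> carrier GU" and gh: "src GU g = tgt GU h"
  then obtain x K y L where x: "g = ultra_class U x" "\<And>n. x n \<in> wball K n" "\<And>n. x n \<in> carrier (G n)"
    and y: "h = ultra_class U y" "\<And>n. y n \<in> wball L n" "\<And>n. y n \<in> carrier (G n)"
    by (elim GU_carrierE) blast
  have eq: "\<forall>\<^sub>F n in U. src (G n) (x n) = tgt (G n) (y n)"
    using gh by (simp add: x(1) y(1) GU_class ultra_class_eq_iff)
  show "gmul GU g h \<in> carrier GU"
    unfolding x(1) y(1) GU_class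
  proof (rule GU_carrierI)
    show "\<forall>\<^sub>F n in U. gmul (G n) (x n) (y n) \<in> wball (K + L) n"
      using eq by eventually_elim
        (rule P.words_upto_mul[OF is_graphing_carrier[OF is_graphing_\<Phi>] x(2) y(2)])
  qed
  show "src GU (gmul GU g h) = src GU h" "tgt GU (gmul GU g h) = tgt GU g"
    unfolding x(1) y(1) GU_class ultra_class_eq_iff
    using eq by (eventually_elim, simp add: P.src_mul P.tgt_mul x(3) y(3))+
  fix k assume "k \<in> carrier GU" and hk: "src GU h = tgt GU k"
  then obtain z M where z: "k = ultra_class U z" "\<And>n. z n \<in> wball M n" "\<And>n. z n \<in> carrier (G n)"
    by (elim GU_carrierE) blast
  have eq': "\<forall>\<^sub>F n in U. src (G n) (y n) = tgt (G n) (z n)"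
    using hk by (simp add: y(1) z(1) GU_class ultra_class_eq_iff)
  show "gmul GU (gmul GU g h) k = gmul GU g (gmul GU h k)"
    unfolding x(1) y(1) z(1) GU_class ultra_class_eq_iff
    using eq eq' by eventually_elim (simp add: P.mul_assoc x(3) y(3) z(3))
qed

sublocale GU: groupoid_laws GU
  by (rule GU_groupoid_laws)

text \<open>Composability of classes holds in almost all coordinates; conversely, factors of a
  product are chosen coordinate by coordinate. Together with \<open>set_inv_GU\<close> this
  identifies words of internal sets with internal sets of words.\<close>

lemma set_mul_GU: "set_mul GU (ultra_set U A) (ultra_set U B) = ultra_set U (\<lambda>n. set_mul (G n) (A n) (B n))"
proof
  show "set_mul GU (ultra_set U A) (ultra_set U B) \<subseteq> ultra_set U (\<lambda>n. set_mul (G n) (A n) (B n))"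
  proof
    fix c assume "c \<in> set_mul GU (ultra_set U A) (ultra_set U B)"
    then obtain g h where gh: "c = gmul GU g h" "g \<in> ultra_set U A" "h \<in> ultra_set U B" "src GU g = tgt GU h"
      unfolding set_mul_def by blast
    obtain x where x: "g = ultra_class U x" "\<forall>\<^sub>F n in U. x n \<in> A n" using gh(2) by (rule ultra_setE)
    obtain y where y: "h = ultra_class U y" "\<forall>\<^sub>F n in U. y n \<in> B n" using gh(3) by (rule ultra_setE)
    have eq: "\<forall>\<^sub>F n in U. src (G n) (x n) = tgt (G n) (y n)"
      using gh(4) by (simp add: x(1) y(1) GU_class ultra_class_eq_iff)
    show "c \<in> ultra_set U (\<lambda>n. set_mul (G n) (A n) (B n))"
      unfolding gh(1) x(1) y(1) GU_class mem_ultra_set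
      using x(2) y(2) eq by eventually_elim (rule set_mulI)
  qed
  show "ultra_set U (\<lambda>n. set_mul (G n) (A n) (B n)) \<subseteq> set_mul GU (ultra_set U A) (ultra_set U B)"
  proof (rule ultra_set_cases)
    fix z assume z: "\<forall>\<^sub>F n in U. z n \<in> set_mul (G n) (A n) (B n)"
    define P where "P n p \<longleftrightarrow> z n = gmul (G n) (fst p) (snd p) \<and> fst p \<in> A n \<and> snd p \<in> B n
      \<and> src (G n) (fst p) = tgt (G n) (snd p)" for n p
    define p where "p n = (SOME p. P n p)" for n
    have P: "\<forall>\<^sub>F n in U. P n (p n)"
      using z
    proof eventually_elim
      case (elim n)
      then have "\<exists>p. P n p" by (auto simp: set_mul_def P_def)
      then show ?case unfolding p_def by (rule someI_ex)
    qed
    have "ultra_class U z = gmul GU (ultra_class U (\<lambda>n. fst (p n))) (ultra_class U (\<lambda>n. snd (p n)))"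
      unfolding GU_class ultra_class_eq_iff using P by eventually_elim (simp add: P_def)
    moreover have "ultra_class U (\<lambda>n. fst (p n)) \<in> ultra_set U A" "ultra_class U (\<lambda>n. snd (p n)) \<in> ultra_set U B"
      "src GU (ultra_class U (\<lambda>n. fst (p n))) = tgt GU (ultra_class U (\<lambda>n. snd (p n)))"
      unfolding GU_class ultra_class_eq_iff mem_ultra_set
      using P by (eventually_elim, simp add: P_def)+
    ultimately show "ultra_class U z \<in> set_mul GU (ultra_set U A) (ultra_set U B)"
      by (simp add: set_mulI)
  qed
qed

lemma set_inv_GU: "set_inv GU (ultra_set U A) = ultra_set U (\<lambda>n. set_inv (G n) (A n))"
proof
  show "set_inv GU (ultra_set U A) \<subseteq> ultra_set U (\<lambda>n. set_inv (G n) (A n))"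
  proof
    fix c assume "c \<in> set_inv GU (ultra_set U A)"
    then obtain x where x: "c = ginv GU (ultra_class U x)" "\<forall>\<^sub>F n in U. x n \<in> A n"
      by (auto simp: set_inv_def ultra_set_eq)
    show "c \<in> ultra_set U (\<lambda>n. set_inv (G n) (A n))"
      unfolding x(1) GU_class mem_ultra_set
      using x(2) by eventually_elim (simp add: set_inv_def)
  qed
  show "ultra_set U (\<lambda>n. set_inv (G n) (A n)) \<subseteq> set_inv GU (ultra_set U A)"
  proof (rule ultra_set_cases)
    fix z assume z: "\<forall>\<^sub>F n in U. z n \<in> set_inv (G n) (A n)"
    define x where "x n = (SOME g. g \<in> A n \<and> z n = ginv (G n) g)" for n
    have x: "\<forall>\<^sub>F n in U. x n \<in> A n \<and> z n = ginv (G n) (x n)"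
      using z
    proof eventually_elim
      case (elim n)
      then have "\<exists>g. g \<in> A n \<and> z n = ginv (G n) g" by (auto simp: set_inv_def)
      then show ?case unfolding x_def by (rule someI_ex)
    qed
    have "ultra_class U z = ginv GU (ultra_class U x)"
      unfolding GU_class ultra_class_eq_iff using x by eventually_elim simp
    moreover have "ultra_class U x \<in> ultra_set U A"
      unfolding mem_ultra_set using x by eventually_elim simp
    ultimately show "ultra_class U z \<in> set_inv GU (ultra_set U A)"
      unfolding set_inv_def by blast
  qed
qed

lemma inj_on_GU:
  assumes "\<forall>\<^sub>F n in U. inj_on (src (G n)) (A n)" "\<forall>\<^sub>F n in U. inj_on (tgt (G n)) (A n)"
  shows "inj_on (src GU) (ultra_set U A)" "inj_on (tgt GU) (ultra_set U A)"
proof -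
  show "inj_on (src GU) (ultra_set U A)"
  proof (rule inj_onI, elim ultra_setE, hypsubst)
    fix x y assume xy: "\<forall>\<^sub>F n in U. x n \<in> A n" "\<forall>\<^sub>F n in U. y n \<in> A n"
      and eq: "src GU (ultra_class U x) = src GU (ultra_class U y)"
    from eq have "\<forall>\<^sub>F n in U. src (G n) (x n) = src (G n) (y n)" by (simp add: GU_class ultra_class_eq_iff)
    with xy assms(1) show "ultra_class U x = ultra_class U y"
      unfolding ultra_class_eq_iff by eventually_elim (auto dest: inj_onD)
  qed
  show "inj_on (tgt GU) (ultra_set U A)"
  proof (rule inj_onI, elim ultra_setE, hypsubst)
    fix x y assume xy: "\<forall>\<^sub>F n in U. x n \<in> A n" "\<forall>\<^sub>F n in U. y n \<in> A n"
      and eq: "tgt GU (ultra_class U x) = tgt GU (ultra_class U y)"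
    from eq have "\<forall>\<^sub>F n in U. tgt (G n) (x n) = tgt (G n) (y n)" by (simp add: GU_class ultra_class_eq_iff)
    with xy assms(2) show "ultra_class U x = ultra_class U y"
      unfolding ultra_class_eq_iff by eventually_elim (auto dest: inj_onD)
  qed
qed

context
  fixes \<Psi> :: "nat \<Rightarrow> 'a graphing"
  assumes \<Psi>: "\<And>n. is_graphing (G n) (\<Psi> n)"
begin

lemma letter_GU: "letter GU (ultra_graphing U \<Psi>) x = ultra_set U (\<lambda>n. letter (G n) (\<Psi> n) x)"
proof (cases x)
  case (Pair i b)
  \<comment> \<open>Neither the given graphings nor \<open>ultra_graphing\<close> have an index 0,
    so letters of index 0 are empty on both sides. For other indices the empty padding in
    \<open>ultra_graphing\<close> matches the empty letters.\<close>
  have 0: "0 \<notin> idx (\<Psi> n)" for n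
    using is_graphing_idx[OF \<Psi>, of 0 n] by auto
  have "(\<lambda>n. set_inv (G n) (if i \<in> idx (\<Psi> n) then bis (\<Psi> n) i else {})) =
      (\<lambda>n. if i \<in> idx (\<Psi> n) then set_inv (G n) (bis (\<Psi> n) i) else {})"
    by (simp add: set_inv_def fun_eq_iff)
  then show ?thesis
    using 0 by (cases "i = 0"; cases b) (simp_all cong: if_cong add: Pair letter_def ultra_graphing_def set_inv_GU ultra_set_empty)
qed

lemma code_word_GU: "code_word GU (ultra_graphing U \<Psi>) c = ultra_set U (\<lambda>n. code_word (G n) (\<Psi> n) c)"
  by (induction c) (simp_all add: units_GU letter_GU set_mul_GU)

text \<open>Each level has finitely many codes, the same for all \<open>n\<close>, and finite unions
  commute with \<open>ultra_set\<close>.\<close>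

lemma words_upto_GU: "words_upto GU (ultra_graphing U \<Psi>) k = ultra_set U (\<lambda>n. words_upto (G n) (\<Psi> n) k)"
  unfolding words_upto_codes by (simp add: code_word_GU ultra_set_UN finite_codes)

end

end


section \<open>The Loeb measure on the arrows\<close>

text \<open>By Caratheodory the outer measure is a measure on the generated sigma-algebra and agrees
  with \<open>M\<close> on the ring; the exhaustion by sets of finite measure makes the extension
  unique. Measurable sets can thus be approximated from outside by countable unions of ring
  elements.\<close>

lemma emeasure_eq_outer_measure:
  assumes R: "ring_of_sets (space M) R" and M: "sets M = sigma_sets (space M) R"
    and A: "range A \<subseteq> R" "(\<Union>i::nat. A i) = space M" "\<And>i. emeasure M (A i) \<noteq> \<infinity>"
    and E: "E \<in> sets M"
  shows "emeasure M E = outer_measure R (emeasure M) E"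
proof -
  interpret ring_of_sets "space M" R by (rule R)
  let ?f = "emeasure M"
  let ?O = "outer_measure R ?f"
  have RM: "R \<subseteq> sets M" unfolding M by auto
  have posf: "positive R ?f" by (simp add: positive_def)
  have ca: "countably_additive R ?f"
    using RM by (auto simp: countably_additive_def intro!: suminf_emeasure)
  have inc: "increasing R ?f"
    using additive_increasing[OF posf] countably_additive_additive[OF posf ca] by blast
  define ls where "ls = lambda_system (space M) (Pow (space M)) ?O"
  have mls: "measure_space (space M) ls ?O"
    using sigma_algebra.caratheodory_lemma
            [OF sigma_algebra_Pow outer_measure_space_outer_measure [OF posf inc]]
    by (simp add: ls_def)
  then have sls: "sigma_algebra (space M) ls"
    by (simp add: measure_space_def)
  have "R \<subseteq> ls"
    unfolding ls_def by (rule algebra_subset_lambda_system[OF posf inc countably_additive_additive[OF posf ca]])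
  then have "sigma_sets (space M) R \<subseteq> ls"
    using sigma_algebra.sigma_sets_subset[OF sls] by simp
  then have ms: "measure_space (space M) (sigma_sets (space M) R) ?O"
    by (intro measure_down[OF mls] sigma_algebra_sigma_sets space_closed)
  define N where "N = measure_of (space M) R ?O"
  have N: "emeasure N X = ?O X" if "X \<in> sigma_sets (space M) R" for X
    using ms that unfolding measure_space_def
    by (intro emeasure_measure_of[OF N_def]) (auto simp: N_def space_closed)
  have "M = N"
  proof (rule measure_eqI_generator_eq[OF _ space_closed _ M _ A])
    show "Int_stable R" by (auto simp: Int_stable_def)
    show "emeasure M X = emeasure N X" if "X \<in> R" for X
      using N[of X] outer_measure_agrees[OF posf ca that] that by auto
    show "sets N = sigma_sets (space M) R"
      by (simp add: N_def space_closed)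
  qed
  then have "emeasure M E = emeasure N E" by simp
  also have "\<dots> = ?O E" using E by (intro N) (simp add: M)
  finally show ?thesis .
qed

context ultra
begin

lemma tendsto_Lim_ultra: "((f :: nat \<Rightarrow> ennreal) \<longlongrightarrow> Lim U f) U"
  by (rule tendsto_Lim_ultrafilter[OF U])

lemma Lim_ultra_eqI: "((f :: nat \<Rightarrow> ennreal) \<longlongrightarrow> l) U \<Longrightarrow> Lim U f = l"
  by (rule tendsto_Lim[OF nontrivial])

lemma Lim_ultra_add: "Lim U (\<lambda>n. f n + g n :: ennreal) = Lim U f + Lim U g"
  by (intro Lim_ultra_eqI tendsto_add tendsto_Lim_ultra)

lemma Lim_ultra_sum: "Lim U (\<lambda>n. \<Sum>i\<in>I. f i n :: ennreal) = (\<Sum>i\<in>I. Lim U (f i))"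
  by (intro Lim_ultra_eqI tendsto_sum tendsto_Lim_ultra)

lemma Lim_ultra_mono: "(\<forall>\<^sub>F n in U. f n \<le> g n) \<Longrightarrow> Lim U f \<le> (Lim U g :: ennreal)"
  by (rule tendsto_le[OF nontrivial tendsto_Lim_ultra tendsto_Lim_ultra])

lemma Lim_ultra_cong: "(\<forall>\<^sub>F n in U. f n = g n) \<Longrightarrow> Lim U f = (Lim U g :: ennreal)"
  by (intro antisym Lim_ultra_mono) (auto elim: eventually_mono)

lemma Lim_ultra_const: "Lim U (\<lambda>n. c :: ennreal) = c"
  by (intro Lim_ultra_eqI tendsto_const)

end

lemma codes_ex: "\<exists>k. c \<in> codes k"
proof
  have "fst x \<le> sum_list (map fst c)" if "x \<in> set c" for x
    using that by (intro member_le_sum_list) auto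
  then show "c \<in> codes (length c + sum_list (map fst c))"
    by (fastforce simp: codes_def)
qed

section \<open>The Loeb measure on internal sets of bounded length\<close>

context graphed_groupoid_seq
begin

lemma bounded_seqs_empty: "(\<lambda>n. {}) \<in> bounded_seqs"
  by (auto simp: bounded_seqs_def)

lemma bounded_seqs_subset:
  "E \<in> bounded_seqs \<Longrightarrow> (\<And>n. F n \<subseteq> E n) \<Longrightarrow> (\<And>n. F n \<in> sets (arrows (G n))) \<Longrightarrow> F \<in> bounded_seqs"
  unfolding bounded_seqs_def by (simp, metis order_trans)

lemma bounded_seqs_sets: "E \<in> bounded_seqs \<Longrightarrow> E n \<in> sets (arrows (G n))"
  by (auto simp: bounded_seqs_def)

lemma bounded_seqs_wball: "wball K \<in> bounded_seqs"
  using sets_wball by (auto simp: bounded_seqs_def)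

lemma bounded_seqs_Diff: "E \<in> bounded_seqs \<Longrightarrow> F \<in> bounded_seqs \<Longrightarrow> (\<lambda>n. E n - F n) \<in> bounded_seqs"
  by (rule bounded_seqs_subset[of E]) (auto simp: bounded_seqs_sets)

lemma bounded_seqs_Un:
  assumes "E \<in> bounded_seqs" "F \<in> bounded_seqs" shows "(\<lambda>n. E n \<union> F n) \<in> bounded_seqs"
proof -
  obtain K L where "\<And>n. E n \<subseteq> wball K n" "\<And>n. F n \<subseteq> wball L n"
    using assms by (auto simp: bounded_seqs_def)
  then have "E n \<union> F n \<subseteq> wball (max K L) n" for n
    using words_upto_mono[of K "max K L" "G n" "\<Phi> n"] words_upto_mono[of L "max K L" "G n" "\<Phi> n"] by fastforce
  moreover have "E n \<union> F n \<in> sets (arrows (G n))" for n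
    using assms by (intro sets.Un bounded_seqs_sets)
  ultimately show ?thesis by (auto simp: bounded_seqs_def)
qed

lemma ring_ultra_sets: "ring_of_sets (\<Union>K. ultra_set U (wball K)) (ultra_set U ` bounded_seqs)"
proof (rule ring_of_setsI)
  show "{} \<in> ultra_set U ` bounded_seqs"
    by (rule image_eqI[OF _ bounded_seqs_empty]) (simp add: ultra_set_empty)
  fix a b assume "a \<in> ultra_set U ` bounded_seqs" "b \<in> ultra_set U ` bounded_seqs"
  then obtain E F where EF: "E \<in> bounded_seqs" "a = ultra_set U E" "F \<in> bounded_seqs" "b = ultra_set U F"
    by blast
  show "a \<union> b \<in> ultra_set U ` bounded_seqs"
    by (rule image_eqI[OF _ bounded_seqs_Un[OF EF(1,3)]]) (simp add: EF ultra_set_Un)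
  show "a - b \<in> ultra_set U ` bounded_seqs"
    by (rule image_eqI[OF _ bounded_seqs_Diff[OF EF(1,3)]]) (simp add: EF ultra_set_Diff)
qed (rule ultra_set_bounded_subset)

definition loeb :: "(nat \<Rightarrow> 'a) set measure" where
  "loeb = extend_measure (\<Union>K. ultra_set U (wball K)) bounded_seqs (ultra_set U)
      (\<lambda>A. Lim U (\<lambda>n. emeasure (arrows (G n)) (A n)))"

lemma arrows_GU: "arrows GU = completion loeb"
  by (simp add: GU_sel ultra_arrows_eq loeb_def)

lemma space_loeb: "space loeb = (\<Union>K. ultra_set U (wball K))"
  unfolding loeb_def by (rule space_extend_measure[OF ultra_set_bounded_subset])

lemma sets_loeb: "sets loeb = sigma_sets (space loeb) (ultra_set U ` bounded_seqs)"
  unfolding space_loeb unfolding loeb_def by (rule sets_extend_measure[OF ultra_set_bounded_subset])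

text \<open>By saturation, a disjoint sequence of internal sets with internal union is eventually empty.\<close>

lemma emeasure_loeb:
  assumes "E \<in> bounded_seqs"
  shows "emeasure loeb (ultra_set U E) = Lim U (\<lambda>n. emeasure (arrows (G n)) (E n))"
proof (rule extend_measure_caratheodory[OF loeb_def assms])
  show "semiring_of_sets (\<Union>K. ultra_set U (wball K)) (ultra_set U ` bounded_seqs)"
    using ring_ultra_sets by (simp add: ring_of_sets_def)
  let ?m = "\<lambda>A. Lim U (\<lambda>n. emeasure (arrows (G n)) (A n))"
  show cong: "?m A = ?m B" if "ultra_set U A = ultra_set U B" for A B
    using that unfolding ultra_set_eq_iff
    by (intro Lim_ultra_cong) (auto elim: eventually_mono)
  show empty: "?m A = 0" if "ultra_set U A = {}" for A
    using cong[of A "\<lambda>n. {}"] that by (simp add: ultra_set_empty Lim_ultra_const)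
  show "0 \<le> ?m A" for A by simp
  fix A :: "nat \<Rightarrow> nat \<Rightarrow> 'a set" and B
  assume A: "A \<in> UNIV \<rightarrow> bounded_seqs" and B: "B \<in> bounded_seqs"
    and disj: "disjoint_family (ultra_set U \<circ> A)" and un: "(\<Union>i. ultra_set U (A i)) = ultra_set U B"
  obtain N where N: "\<forall>\<^sub>F n in U. B n \<subseteq> (\<Union>i<N. A i n)"
    using saturation[of B A] un by auto
  then have "ultra_set U B \<subseteq> (\<Union>i<N. ultra_set U (A i))"
    by (simp add: ultra_set_subset_iff flip: ultra_set_UN)
  then have "ultra_set U (A i) = {}" if "N \<le> i" for i
  proof -
    have "ultra_set U (A i) \<inter> ultra_set U (A j) = {}" if "j < N" for j
      using disj \<open>N \<le> i\<close> that by (auto simp: disjoint_family_on_def)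
    moreover have "ultra_set U (A i) \<subseteq> (\<Union>i<N. ultra_set U (A i))"
      using un \<open>ultra_set U B \<subseteq> (\<Union>i<N. ultra_set U (A i))\<close> by blast
    ultimately show ?thesis by blast
  qed
  then have "(\<Sum>i. ?m (A i)) = (\<Sum>i<N. ?m (A i))"
    by (intro suminf_finite) (auto intro: empty)
  also have "\<dots> = Lim U (\<lambda>n. \<Sum>i<N. emeasure (arrows (G n)) (A i n))"
    by (rule Lim_ultra_sum[symmetric])
  also have "\<dots> = ?m B"
  proof (rule Lim_ultra_cong)
    \<comment> \<open>Disjointness and inclusion concern finitely many indices, so they hold
      simultaneously for almost all \<open>n\<close>, where finite additivity in \<open>G n\<close>
      applies.\<close>
    have dj: "\<forall>\<^sub>F n in U. \<forall>i\<in>{..<N}. \<forall>j\<in>{..<N}. i \<noteq> j \<longrightarrow> A i n \<inter> A j n = {}"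
    proof (intro eventually_ball_finite ballI finite_lessThan)
      fix i j
      show "\<forall>\<^sub>F n in U. i \<noteq> j \<longrightarrow> A i n \<inter> A j n = {}"
        using disj by (cases "i = j")
          (auto simp: disjoint_family_on_def simp flip: ultra_set_Int ultra_set_empty_iff)
    qed
    have "\<forall>\<^sub>F n in U. A i n \<subseteq> B n" for i
      using un by (auto simp flip: ultra_set_subset_iff)
    then have sub: "\<forall>\<^sub>F n in U. \<forall>i\<in>{..<N}. A i n \<subseteq> B n"
      by (intro eventually_ball_finite) auto
    show "\<forall>\<^sub>F n in U. (\<Sum>i<N. emeasure (arrows (G n)) (A i n)) = emeasure (arrows (G n)) (B n)"
      using dj sub N
    proof eventually_elim
      case (elim n)
      have "A i n \<in> sets (arrows (G n))" for i
        using A by (intro bounded_seqs_sets) auto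
      with elim have "(\<Sum>i<N. emeasure (arrows (G n)) (A i n)) = emeasure (arrows (G n)) (\<Union>i<N. A i n)"
        by (intro sum_emeasure) (auto simp: disjoint_family_on_def)
      moreover have "(\<Union>i<N. A i n) = B n" using elim by blast
      ultimately show ?case by simp
    qed
  qed
  finally show "(\<Sum>i. ?m (A i)) = ?m B" .
qed

lemma sets_loeb_ultra_set: "E \<in> bounded_seqs \<Longrightarrow> ultra_set U E \<in> sets loeb"
  unfolding sets_loeb by auto

lemma GU_ultra_set:
  assumes "E \<in> bounded_seqs"
  shows "ultra_set U E \<in> sets (arrows GU)"
    and "emeasure (arrows GU) (ultra_set U E) = Lim U (\<lambda>n. emeasure (arrows (G n)) (E n))"
  using sets_loeb_ultra_set[OF assms] emeasure_loeb[OF assms] by (simp_all add: arrows_GU)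

lemma bisection_GU:
  assumes "E \<in> bounded_seqs" "\<And>n. bisection (G n) (E n)"
  shows "bisection GU (ultra_set U E)"
  using GU_ultra_set(1)[OF assms(1)] inj_on_GU[of E] assms(2) by (simp add: bisection_def)

text \<open>The words in \<open>\<Phi> n\<close> are enumerated through the countable type of codes
  and made disjoint. The pieces are bisections, hence of measure at most 1, and their ultraproducts
  partition the carrier of \<open>GU\<close>; this provides both sigma-finiteness and a
  decomposition into bisections.\<close>

definition piece :: "nat \<Rightarrow> nat \<Rightarrow> 'a set" where
  "piece j n = code_word (G n) (\<Phi> n) (from_nat j) - (\<Union>i<j. code_word (G n) (\<Phi> n) (from_nat i))"

lemma code_word_bounded: "(\<lambda>n. code_word (G n) (\<Phi> n) c) \<in> bounded_seqs"
proof -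
  obtain K where "c \<in> codes K" using codes_ex by blast
  then have "code_word (G n) (\<Phi> n) c \<subseteq> wball K n" for n
    unfolding words_upto_codes by blast
  moreover have "code_word (G n) (\<Phi> n) c \<in> sets (arrows (G n))" for n
    using P.bisection_code_word[OF is_graphing_\<Phi>] by (simp add: bisection_def)
  ultimately show ?thesis by (auto simp: bounded_seqs_def)
qed

lemma bisection_piece: "bisection (G n) (piece j n)"
  unfolding piece_def
  by (intro bisection_Diff P.bisection_code_word is_graphing_\<Phi> sets.finite_UN
      bounded_seqs_sets[OF code_word_bounded] finite_lessThan)

lemma piece_bounded: "piece j \<in> bounded_seqs"
  by (rule bounded_seqs_subset[OF code_word_bounded[of "from_nat j"]])
    (use bisection_piece in \<open>auto simp: bisection_def piece_def\<close>)

lemma ultra_set_piece: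
  "ultra_set U (piece j) = ultra_set U (\<lambda>n. code_word (G n) (\<Phi> n) (from_nat j))
    - (\<Union>i<j. ultra_set U (\<lambda>n. code_word (G n) (\<Phi> n) (from_nat i)))"
  by (simp add: piece_def[abs_def] ultra_set_Diff ultra_set_UN)

lemma UN_piece: "(\<Union>j. ultra_set U (piece j)) = (\<Union>K. ultra_set U (wball K))"
proof
  show "(\<Union>j. ultra_set U (piece j)) \<subseteq> (\<Union>K. ultra_set U (wball K))"
    using ultra_set_bounded_subset piece_bounded by blast
  show "(\<Union>K. ultra_set U (wball K)) \<subseteq> (\<Union>j. ultra_set U (piece j))"
  proof safe
    fix x K assume "x \<in> ultra_set U (wball K)"
    then obtain c where "x \<in> ultra_set U (\<lambda>n. code_word (G n) (\<Phi> n) c)"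
      by (auto simp: words_upto_codes ultra_set_UN[OF finite_codes])
    then have *: "x \<in> ultra_set U (\<lambda>n. code_word (G n) (\<Phi> n) (from_nat (to_nat c)))" by simp
    \<comment> \<open>The first word containing \<open>x\<close> determines the piece of
      \<open>x\<close>.\<close>
    define j where "j = (LEAST j. x \<in> ultra_set U (\<lambda>n. code_word (G n) (\<Phi> n) (from_nat j)))"
    have "x \<in> ultra_set U (\<lambda>n. code_word (G n) (\<Phi> n) (from_nat j))"
      unfolding j_def by (rule LeastI[where P = "\<lambda>j. x \<in> ultra_set U (\<lambda>n. code_word (G n) (\<Phi> n) (from_nat j))", OF *])
    moreover have "x \<notin> ultra_set U (\<lambda>n. code_word (G n) (\<Phi> n) (from_nat i))" if "i < j" for i
      using not_less_Least[OF that[unfolded j_def]] .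
    ultimately have "x \<in> ultra_set U (piece j)" by (auto simp: ultra_set_piece)
    then show "x \<in> (\<Union>j. ultra_set U (piece j))" by blast
  qed
qed

lemma disjoint_piece: "disjoint_family (\<lambda>j. ultra_set U (piece j))"
  unfolding disjoint_family_on_def
proof (intro ballI impI)
  fix i j :: nat assume "i \<noteq> j"
  then consider "i < j" | "j < i" by linarith
  then show "ultra_set U (piece i) \<inter> ultra_set U (piece j) = {}"
    by cases (auto simp: ultra_set_piece)
qed

lemma emeasure_loeb_piece: "emeasure loeb (ultra_set U (piece j)) \<noteq> \<infinity>"
proof -
  have "emeasure loeb (ultra_set U (piece j)) \<le> Lim U (\<lambda>n. 1)"
    unfolding emeasure_loeb[OF piece_bounded]
    by (intro Lim_ultra_mono always_eventually allI P.emeasure_bisection_le_1 bisection_piece)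
  then show ?thesis by (auto simp: Lim_ultra_const top_unique)
qed

text \<open>The Loeb measure is an outer measure on the ring of internal sets, by sigma-finiteness
  along the pieces. The cover contains all of \<open>E\<close>, including its null part, so that
  generation is not lost later.\<close>

lemma cover_by_internal:
  assumes E: "E \<in> sets (arrows GU)" "emeasure (arrows GU) E < \<infinity>" and d: "d > 0"
  shows "\<exists>A. (\<forall>i::nat. A i \<in> bounded_seqs) \<and> E \<subseteq> (\<Union>i. ultra_set U (A i)) \<and>
    (\<Sum>i. emeasure loeb (ultra_set U (A i))) \<le> emeasure (arrows GU) E + d"
proof -
  let ?R = "ultra_set U ` bounded_seqs"
  interpret R: ring_of_sets "space loeb" ?R
    unfolding space_loeb by (rule ring_ultra_sets)
  \<comment> \<open>As \<open>arrows GU\<close> is a completion, \<open>E\<close> is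
    \<open>S\<close> together with a subset of a null set \<open>N'\<close>; the larger set
    \<open>S \<union> N'\<close>, of the measure of \<open>S\<close>, is covered instead.\<close>
  obtain S N N' where E_eq: "E = S \<union> N" and N: "N \<subseteq> N'" "N' \<in> null_sets loeb" and S: "S \<in> sets loeb"
    using E(1) unfolding arrows_GU by (rule sets_completionE)
  have SN: "S \<union> N' \<in> sets loeb" using S N by auto
  have "outer_measure ?R (emeasure loeb) (S \<union> N') = emeasure loeb (S \<union> N')"
  proof (rule emeasure_eq_outer_measure[symmetric, OF R.ring_of_sets_axioms sets_loeb _ _ _ SN])
    show "range (\<lambda>j. ultra_set U (piece j)) \<subseteq> ?R" using piece_bounded by blast
    show "(\<Union>j. ultra_set U (piece j)) = space loeb" by (simp add: UN_piece space_loeb)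
    show "emeasure loeb (ultra_set U (piece j)) \<noteq> \<infinity>" for j by (rule emeasure_loeb_piece)
  qed
  also have "\<dots> = emeasure loeb S"
    using S N(2) by (rule emeasure_Un_null_set)
  also have "\<dots> = emeasure (arrows GU) S"
    using S by (simp add: arrows_GU)
  also have "\<dots> \<le> emeasure (arrows GU) E"
    using E by (intro emeasure_mono) (auto simp: E_eq)
  \<comment> \<open>Finiteness of the measure of \<open>E\<close> makes adding \<open>d\<close> a
    strict increase, which leaves room for an approximating cover.\<close>
  also have "\<dots> < emeasure (arrows GU) E + d"
    using E(2) d ennreal_add_left_cancel_less[of "emeasure (arrows GU) E" 0 d] by simp
  finally have "outer_measure ?R (emeasure loeb) (S \<union> N') < emeasure (arrows GU) E + d" .
  from R.outer_measure_close[OF this]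
  obtain B where B: "range B \<subseteq> ?R" "S \<union> N' \<subseteq> (\<Union>i. B i)"
      "(\<Sum>i. emeasure loeb (B i)) < emeasure (arrows GU) E + d"
    by blast
  then have "\<forall>i. \<exists>a. a \<in> bounded_seqs \<and> B i = ultra_set U a" by blast
  then obtain A where "\<And>i. A i \<in> bounded_seqs \<and> B i = ultra_set U (A i)" by metis
  then show ?thesis
    using B E_eq N by (intro exI[of _ A]) auto
qed

text \<open>Intersecting an internal cover with the pieces cuts it into bisections. As the pieces
  partition the carrier, the total measure is unchanged.\<close>

lemma cover_by_bisections:
  assumes E: "E \<in> sets (arrows GU)" "emeasure (arrows GU) E < \<infinity>" and d: "d > 0"
  shows "\<exists>F. (\<forall>l::nat. F l \<in> bounded_seqs \<and> (\<forall>n. bisection (G n) (F l n))) \<and> E \<subseteq> (\<Union>l. ultra_set U (F l)) \<and>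
    (\<Sum>l. emeasure (arrows GU) (ultra_set U (F l))) \<le> emeasure (arrows GU) E + d"
proof -
  obtain A where A: "\<And>i::nat. A i \<in> bounded_seqs" "E \<subseteq> (\<Union>i. ultra_set U (A i))"
    "(\<Sum>i. emeasure loeb (ultra_set U (A i))) \<le> emeasure (arrows GU) E + d"
    using cover_by_internal[OF assms] by blast
  define F where "F l n = A (fst (prod_decode l)) n \<inter> piece (snd (prod_decode l)) n" for l n
  have Fb: "bisection (G n) (F l n)" for l n
    unfolding F_def by (subst Int_commute) (intro bisection_Int bisection_piece bounded_seqs_sets A)
  then have FB: "F l \<in> bounded_seqs" for l
    by (intro bounded_seqs_subset[OF A(1)[of "fst (prod_decode l)"]]) (auto simp: F_def bisection_def)
  have Fu: "ultra_set U (F l) = ultra_set U (A (fst (prod_decode l))) \<inter> ultra_set U (piece (snd (prod_decode l)))" for l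
    by (simp add: F_def[abs_def] ultra_set_Int)
  have "E \<subseteq> (\<Union>l. ultra_set U (F l))"
  proof
    fix x assume "x \<in> E"
    then obtain i where i: "x \<in> ultra_set U (A i)" using A(2) by blast
    then have "x \<in> (\<Union>j. ultra_set U (piece j))"
      unfolding UN_piece using A(1)[of i] ultra_set_bounded_subset by blast
    then obtain j where "x \<in> ultra_set U (piece j)" by blast
    with i have "x \<in> ultra_set U (F (prod_encode (i, j)))" by (simp add: Fu)
    then show "x \<in> (\<Union>l. ultra_set U (F l))" by blast
  qed
  moreover have "(\<Sum>l. emeasure (arrows GU) (ultra_set U (F l))) \<le> emeasure (arrows GU) E + d"
  proof -
    define f where "f = (\<lambda>(i, j). emeasure loeb (ultra_set U (A i) \<inter> ultra_set U (piece j)))"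
    have sum: "emeasure loeb (ultra_set U (A i)) = (\<Sum>j. f (i, j))" for i
    proof -
      have "(\<Sum>j. f (i, j)) = emeasure loeb (\<Union>j. ultra_set U (A i) \<inter> ultra_set U (piece j))"
        unfolding f_def case_prod_conv
        using disjoint_piece A(1) piece_bounded sets_loeb_ultra_set
        by (intro suminf_emeasure) (auto simp: disjoint_family_on_def)
      also have "(\<Union>j. ultra_set U (A i) \<inter> ultra_set U (piece j)) = ultra_set U (A i) \<inter> (\<Union>j. ultra_set U (piece j))"
        by blast
      also have "\<dots> = ultra_set U (A i)"
        unfolding UN_piece using A(1)[of i] ultra_set_bounded_subset by blast
      finally show ?thesis ..
    qed
    have "emeasure (arrows GU) (ultra_set U (F l)) = f (prod_decode l)" for l
      using GU_ultra_set(2)[OF FB] emeasure_loeb[OF FB] by (simp add: Fu f_def case_prod_unfold)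
    then have "(\<Sum>l. emeasure (arrows GU) (ultra_set U (F l))) = (\<Sum>l. f (prod_decode l))" by simp
    also have "\<dots> = (\<Sum>i. emeasure loeb (ultra_set U (A i)))"
      by (rule suminf_ennreal_2dimen[OF sum])
    finally show ?thesis using A(3) by simp
  qed
  ultimately show ?thesis using Fb FB by (intro exI[of _ F]) auto
qed

end


section \<open>Comparison of the costs\<close>

text \<open>Padding with empty sets to all natural numbers makes the cost an ordinary series,
  whatever the index set.\<close>

definition member :: "'a graphing \<Rightarrow> nat \<Rightarrow> 'a set" where
  "member \<Phi> i = (if i \<in> idx \<Phi> then bis \<Phi> i else {})"

lemma graphing_cost_suminf: "graphing_cost G \<Phi> = (\<Sum>i. emeasure (arrows G) (member \<Phi> i))"
proof -
  have "graphing_cost G \<Phi> = (\<Sum>\<^sub>\<infinity>i\<in>UNIV. emeasure (arrows G) (member \<Phi> i))"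
    unfolding graphing_cost_def by (rule infsum_cong_neutral) (auto simp: member_def)
  also have "\<dots> = (\<Sum>i. emeasure (arrows G) (member \<Phi> i))"
    by (intro sums_unique has_sum_imp_sums has_sum_infsum nonneg_summable_on_complete) simp
  finally show ?thesis .
qed

lemma ultra_graphing_sel:
  "idx (ultra_graphing U \<Phi>) = {1..}" "bis (ultra_graphing U \<Phi>) i = ultra_set U (\<lambda>n. member (\<Phi> n) i)"
  by (simp_all add: ultra_graphing_def member_def)

lemma bisection_member: "is_graphing G \<Phi> \<Longrightarrow> bisection G (member \<Phi> i)"
  by (simp add: member_def is_graphing_bisection bisection_empty)

lemma member_0: "is_graphing G \<Phi> \<Longrightarrow> member \<Phi> 0 = {}"
  using is_graphing_idx[of G \<Phi> 0] by (auto simp: member_def)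

lemma ennreal_suminf_split:
  fixes f :: "nat \<Rightarrow> ennreal"
  shows "suminf f = (\<Sum>i<K. f i) + (\<Sum>i. f (i + K))"
proof (induction K)
  case (Suc K)
  have "(\<Sum>i. f (i + K)) = (\<Sum>i. f (Suc i + K)) + f (0 + K)"
    by (intro sums_unique[symmetric] sums_Suc[of "\<lambda>i. f (i + K)"] summable_sums summableI)
  with Suc show ?case by (simp add: ac_simps)
qed simp

lemma coarse_leI:
  "(\<And>k. k \<in> idx \<Psi> \<Longrightarrow> bis \<Psi> k \<subseteq> words_upto G \<Phi> (M k)) \<Longrightarrow> coarse_le G M \<Psi> \<Phi>"
  unfolding coarse_le_def by (intro ballI AE_I2) blast

context graphed_groupoid_seq
begin

lemma member_bounded: "(\<lambda>n. member (\<Phi> n) k) \<in> bounded_seqs"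
proof -
  have "member (\<Phi> n) k \<subseteq> wball k n" for n
  proof (cases "k \<in> idx (\<Phi> n)")
    case True
    then show ?thesis
      using P.bis_subset_words_upto[OF is_graphing_carrier[OF is_graphing_\<Phi>] True order_refl]
        is_graphing_idx[OF is_graphing_\<Phi> True] by (simp add: member_def)
  qed (simp add: member_def)
  then show ?thesis
    using bisection_member[OF is_graphing_\<Phi>] unfolding bounded_seqs_def bisection_def by blast
qed

lemma is_graphing_ultra:
  assumes "\<And>n. is_graphing (G n) (\<Psi> n)" "\<And>k. (\<lambda>n. member (\<Psi> n) k) \<in> bounded_seqs"
  shows "is_graphing GU (ultra_graphing U \<Psi>)"
  unfolding is_graphing_def ultra_graphing_sel
  using assms by (auto intro!: bisection_GU bisection_member)

text \<open>The series stands outside the ultralimit. In general it is only at most the ultralimit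
  of the costs; for \<open>\<Phi>\<close> equality is a hypothesis of the theorem.\<close>

lemma ultra_graphing_cost:
  assumes \<Psi>: "\<And>n. is_graphing (G n) (\<Psi> n)" "\<And>k. (\<lambda>n. member (\<Psi> n) k) \<in> bounded_seqs"
  shows "graphing_cost GU (ultra_graphing U \<Psi>) =
    (\<Sum>k. Lim U (\<lambda>n. emeasure (arrows (G n)) (member (\<Psi> n) k)))"
proof -
  have "emeasure (arrows GU) (member (ultra_graphing U \<Psi>) k) =
    Lim U (\<lambda>n. emeasure (arrows (G n)) (member (\<Psi> n) k))" for k
  proof (cases "k = 0")
    case True
    have "member (ultra_graphing U \<Psi>) 0 = {}" by (simp add: member_def ultra_graphing_sel)
    then show ?thesis by (simp add: True member_0[OF \<Psi>(1)] Lim_ultra_const)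
  next
    case False
    then have "member (ultra_graphing U \<Psi>) k = ultra_set U (\<lambda>n. member (\<Psi> n) k)"
      by (simp add: member_def[of "ultra_graphing U \<Psi>"] ultra_graphing_sel)
    then show ?thesis using GU_ultra_set(2)[OF \<Psi>(2)] by simp
  qed
  then show ?thesis by (simp add: graphing_cost_suminf)
qed

section \<open>Bounding the cost of the ultraproduct by coarse costs\<close>

lemma carrier_subset_subgroupoid:
  assumes H: "subgroupoid GU H" and sub: "\<And>k. ultra_set U (\<lambda>n. member (\<Phi> n) k) \<subseteq> H"
  shows "carrier GU \<subseteq> H"
proof -
  have g: "is_graphing GU (ultra_graphing U \<Phi>)"
    by (intro is_graphing_ultra is_graphing_\<Phi> member_bounded)
  have "words_upto GU (ultra_graphing U \<Phi>) K \<subseteq> H" for K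
    using sub by (intro GU.words_upto_subset_subgroupoid[OF is_graphing_carrier[OF g] H])
      (auto simp: ultra_graphing_sel)
  then show ?thesis
    unfolding carrier_GU words_upto_GU[of \<Phi>, OF is_graphing_\<Phi>] by blast
qed

text \<open>The members of an almost optimal \<open>\<Psi>\<^sub>n\<close> are cut down by null sets to have bounded length, and what
  \<open>\<Phi>\<^sub>n\<close> loses by this is restored in the ultraproduct at no cost.\<close>

lemma GU_cost_le_Lim_coarse_cost:
  "groupoid_cost GU \<le> Lim U (\<lambda>n. coarse_cost M (G n) (\<Phi> n))"
proof (rule ennreal_le_epsilon)
  let ?L = "Lim U (\<lambda>n. coarse_cost M (G n) (\<Phi> n))"
  fix e :: real assume fin: "?L < top" and e: "0 < e"
  \<comment> \<open>Where the coarse cost is infinite an arbitrary graphing is taken; since the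
    ultralimit is finite, this concerns only exceptional \<open>n\<close>.\<close>
  have "\<exists>\<Psi>. is_graphing (G n) \<Psi> \<and> (coarse_cost M (G n) (\<Phi> n) < top \<longrightarrow>
      coarse_equiv (G n) M \<Psi> (\<Phi> n) \<and> graphing_cost (G n) \<Psi> \<le> coarse_cost M (G n) (\<Phi> n) + ennreal e)" for n
  proof (cases "coarse_cost M (G n) (\<Phi> n) < top")
    case True
    then have "coarse_cost M (G n) (\<Phi> n) < coarse_cost M (G n) (\<Phi> n) + ennreal e"
      using e ennreal_add_left_cancel_less[of "coarse_cost M (G n) (\<Phi> n)" 0 "ennreal e"] by simp
    then obtain \<Psi> where "is_graphing (G n) \<Psi>" "coarse_equiv (G n) M \<Psi> (\<Phi> n)"
      "graphing_cost (G n) \<Psi> < coarse_cost M (G n) (\<Phi> n) + ennreal e"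
      unfolding coarse_cost_def Inf_less_iff by blast
    then show ?thesis by (blast intro: less_imp_le)
  next
    case False
    then show ?thesis using is_graphing_\<Phi> by blast
  qed
  then obtain \<Psi> where \<Psi>: "\<And>n. is_graphing (G n) (\<Psi> n)"
    and \<Psi>_equiv: "\<And>n. coarse_cost M (G n) (\<Phi> n) < top \<Longrightarrow> coarse_equiv (G n) M (\<Psi> n) (\<Phi> n)"
    and \<Psi>_cost: "\<And>n. coarse_cost M (G n) (\<Phi> n) < top \<Longrightarrow>
      graphing_cost (G n) (\<Psi> n) \<le> coarse_cost M (G n) (\<Phi> n) + ennreal e"
    by metis
  have ev: "\<forall>\<^sub>F n in U. coarse_cost M (G n) (\<Phi> n) < top"
    using order_tendstoD(2)[OF tendsto_Lim_ultra fin] .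
  \<comment> \<open>The cut at level \<open>M k\<close> gives a length bound uniform in
    \<open>n\<close>, so the members define internal sets of \<open>GU\<close>. For almost all
    \<open>n\<close> it removes only null sets, by coarse inclusion of \<open>\<Psi> n\<close> in
    \<open>\<Phi> n\<close>.\<close>
  define \<Psi>' where "\<Psi>' n = \<lparr>idx = idx (\<Psi> n), bis = (\<lambda>k. bis (\<Psi> n) k \<inter> wball (M k) n)\<rparr>" for n
  have member_\<Psi>': "member (\<Psi>' n) k = member (\<Psi> n) k \<inter> wball (M k) n" for n k
    by (simp add: member_def \<Psi>'_def)
  have \<Psi>': "is_graphing (G n) (\<Psi>' n)" for n
    using \<Psi>[of n] by (auto simp: is_graphing_def \<Psi>'_def intro!: bisection_Int sets_wball)
  have \<Psi>'_bounded: "(\<lambda>n. member (\<Psi>' n) k) \<in> bounded_seqs" for k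
    using bisection_member[OF \<Psi>'] by (intro bounded_seqs_subset[OF bounded_seqs_wball[of "M k"]])
      (auto simp: member_\<Psi>' bisection_def)
  define N where "N k n = member (\<Phi> n) k - words_upto (G n) (\<Psi>' n) (M k)" for k n
  have N_bis: "bisection (G n) (N k n)" for k n
    unfolding N_def by (intro bisection_Diff bisection_member is_graphing_\<Phi> P.sets_words_upto \<Psi>')
  have N_bounded: "N k \<in> bounded_seqs" for k
    using N_bis by (intro bounded_seqs_subset[OF member_bounded[of k]]) (auto simp: N_def bisection_def)
  have N_null: "emeasure (arrows (G n)) (N k n) = 0" if "coarse_cost M (G n) (\<Phi> n) < top" for k n
  proof (cases "k \<in> idx (\<Phi> n)")
    case True
    have eq: "coarse_le (G n) M (\<Psi> n) (\<Phi> n)" "coarse_le (G n) M (\<Phi> n) (\<Psi> n)"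
      using \<Psi>_equiv[OF that] by (auto simp: coarse_equiv_def)
    \<comment> \<open>\<open>?A\<close> is what words in \<open>\<Psi> n\<close> miss, null by
      coarse equivalence; \<open>?B\<close> is what words lose by the cut, null by
      \<open>words_upto_Diff_null\<close>.\<close>
    let ?A = "bis (\<Phi> n) k - words_upto (G n) (\<Psi> n) (M k)"
    let ?B = "words_upto (G n) (\<Psi> n) (M k) - words_upto (G n) (\<Psi>' n) (M k)"
    have "emeasure (arrows (G n)) (bis (\<Psi> n) i - bis (\<Psi>' n) i) = 0" if "i \<in> idx (\<Psi> n)" for i
      using eq(1) that unfolding P.coarse_le_iff[OF \<Psi> is_graphing_\<Phi>] by (simp add: \<Psi>'_def Diff_Int)
    then have "emeasure (arrows (G n)) ?B = 0"
      by (intro P.words_upto_Diff_null \<Psi> \<Psi>') (auto simp: \<Psi>'_def)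
    moreover have "emeasure (arrows (G n)) ?A = 0"
      using eq(2) True unfolding P.coarse_le_iff[OF is_graphing_\<Phi> \<Psi>] by blast
    moreover have "?A \<in> sets (arrows (G n))" "?B \<in> sets (arrows (G n))"
      using is_graphing_bisection[OF is_graphing_\<Phi> True] P.sets_words_upto[OF \<Psi>] P.sets_words_upto[OF \<Psi>']
      by (auto simp: bisection_def)
    ultimately have AB: "?A \<union> ?B \<in> null_sets (arrows (G n))"
      by (intro null_sets.Un) auto
    have "N k n \<subseteq> ?A \<union> ?B" using True by (auto simp: N_def member_def)
    moreover have "N k n \<in> sets (arrows (G n))" using N_bis by (simp add: bisection_def)
    ultimately show ?thesis using null_sets_subset[OF AB] null_setsD1 by blast
  qed (simp add: N_def member_def)
  have "groupoid_cost GU \<le> graphing_cost GU (ultra_graphing U \<Psi>')"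
  proof (rule groupoid_cost_le_add_null[OF GU_groupoid_laws is_graphing_ultra[OF \<Psi>' \<Psi>'_bounded]])
    show "bisection GU (ultra_set U (N k))" for k
      by (rule bisection_GU[OF N_bounded N_bis])
    show "emeasure (arrows GU) (ultra_set U (N k)) = 0" for k
    proof -
      have "Lim U (\<lambda>n. emeasure (arrows (G n)) (N k n)) = Lim U (\<lambda>n. 0)"
        using ev by (intro Lim_ultra_cong) (auto elim: eventually_mono simp: N_null)
      then show ?thesis by (simp add: GU_ultra_set(2)[OF N_bounded] Lim_ultra_const)
    qed
    fix H assume H: "subgroupoid GU H"
      "\<And>i. i \<in> idx (ultra_graphing U \<Psi>') \<Longrightarrow> bis (ultra_graphing U \<Psi>') i \<subseteq> H" "\<And>k. ultra_set U (N k) \<subseteq> H"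
    show "carrier GU \<subseteq> H"
    proof (rule carrier_subset_subgroupoid[OF H(1)])
      fix k
      have "words_upto GU (ultra_graphing U \<Psi>') (M k) \<subseteq> H"
        by (rule GU.words_upto_subset_subgroupoid[OF is_graphing_carrier[OF is_graphing_ultra[OF \<Psi>' \<Psi>'_bounded]] H(1,2)])
      moreover have "ultra_set U (\<lambda>n. member (\<Phi> n) k) \<subseteq>
          ultra_set U (\<lambda>n. words_upto (G n) (\<Psi>' n) (M k)) \<union> ultra_set U (N k)"
        unfolding ultra_set_Un[symmetric] by (intro ultra_set_mono) (auto simp: N_def)
      ultimately show "ultra_set U (\<lambda>n. member (\<Phi> n) k) \<subseteq> H"
        using H(3)[of k] unfolding words_upto_GU[of \<Psi>', OF \<Psi>'] by blast
    qed
  qed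
  also have "\<dots> = (\<Sum>k. Lim U (\<lambda>n. emeasure (arrows (G n)) (member (\<Psi>' n) k)))"
    by (rule ultra_graphing_cost[OF \<Psi>' \<Psi>'_bounded])
  also have "\<dots> \<le> ?L + ennreal e"
  \<comment> \<open>The Fatou argument: partial sums commute with the ultralimit, and each is
    bounded by the cost of \<open>\<Psi> n\<close>.\<close>
  proof (rule suminf_le_const[OF summableI])
    fix K
    have "(\<Sum>k<K. Lim U (\<lambda>n. emeasure (arrows (G n)) (member (\<Psi>' n) k))) =
        Lim U (\<lambda>n. \<Sum>k<K. emeasure (arrows (G n)) (member (\<Psi>' n) k))"
      by (rule Lim_ultra_sum[symmetric])
    also have "\<dots> \<le> Lim U (\<lambda>n. coarse_cost M (G n) (\<Phi> n) + ennreal e)"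
    proof (rule Lim_ultra_mono)
      show "\<forall>\<^sub>F n in U. (\<Sum>k<K. emeasure (arrows (G n)) (member (\<Psi>' n) k)) \<le> coarse_cost M (G n) (\<Phi> n) + ennreal e"
        using ev
      proof eventually_elim
        case (elim n)
        have "(\<Sum>k<K. emeasure (arrows (G n)) (member (\<Psi>' n) k)) \<le> (\<Sum>k<K. emeasure (arrows (G n)) (member (\<Psi> n) k))"
          using bisection_member[OF \<Psi>] by (intro sum_mono emeasure_mono) (auto simp: member_\<Psi>' bisection_def)
        also have "\<dots> \<le> graphing_cost (G n) (\<Psi> n)"
          unfolding graphing_cost_suminf by (intro sum_le_suminf summableI) auto
        also have "\<dots> \<le> coarse_cost M (G n) (\<Phi> n) + ennreal e" by (rule \<Psi>_cost[OF elim])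
        finally show ?case .
      qed
    qed
    also have "\<dots> = ?L + ennreal e" by (simp add: Lim_ultra_add Lim_ultra_const)
    finally show "(\<Sum>k<K. Lim U (\<lambda>n. emeasure (arrows (G n)) (member (\<Psi>' n) k))) \<le> ?L + ennreal e" .
  qed
  finally show "groupoid_cost GU \<le> ?L + ennreal e" .
qed

section \<open>Internal graphings built from a generating graphing of the ultraproduct\<close>

lemma graphing_cover:
  assumes \<Psi>: "is_graphing GU \<Psi>" and fin: "graphing_cost GU \<Psi> < \<infinity>" and e: "0 < (e :: real)"
  shows "\<exists>F. (\<forall>m::nat. F m \<in> bounded_seqs \<and> (\<forall>n. bisection (G n) (F m n))) \<and>
    (\<forall>k\<in>idx \<Psi>. bis \<Psi> k \<subseteq> (\<Union>m. ultra_set U (F m))) \<and>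
    (\<Sum>m. emeasure (arrows GU) (ultra_set U (F m))) \<le> graphing_cost GU \<Psi> + ennreal e"
proof -
  let ?\<mu> = "emeasure (arrows GU)"
  \<comment> \<open>The allowances \<open>e / 2^(k+1)\<close> for the members of
    \<open>\<Psi>\<close> add up to \<open>e\<close>.\<close>
  define d where "d k = ennreal (e * (1/2) ^ Suc k)" for k
  have d_pos: "d k > 0" for k using e by (simp add: d_def)
  have d_sum: "(\<Sum>k. d k) = ennreal e"
    unfolding d_def
  proof (rule suminf_ennreal_eq)
    show "(\<lambda>k. e * (1/2) ^ Suc k) sums e" using sums_mult[OF power_half_series, of e] by simp
  qed (use e in simp)
  have "?\<mu> (member \<Psi> k) < \<infinity>" for k
    using fin unfolding graphing_cost_suminf by (auto dest: ennreal_suminf_lessD)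
  moreover have "member \<Psi> k \<in> sets (arrows GU)" for k
    using bisection_member[OF \<Psi>] by (simp add: bisection_def)
  ultimately have "\<forall>k. \<exists>F. (\<forall>l::nat. F l \<in> bounded_seqs \<and> (\<forall>n. bisection (G n) (F l n))) \<and>
      member \<Psi> k \<subseteq> (\<Union>l. ultra_set U (F l)) \<and> (\<Sum>l. ?\<mu> (ultra_set U (F l))) \<le> ?\<mu> (member \<Psi> k) + d k"
    using cover_by_bisections d_pos by blast
  then obtain F where F: "\<And>k l. F k l \<in> bounded_seqs" "\<And>k l n. bisection (G n) (F k l n)"
    "\<And>k. member \<Psi> k \<subseteq> (\<Union>l. ultra_set U (F k l))"
    "\<And>k. (\<Sum>l. ?\<mu> (ultra_set U (F k l))) \<le> ?\<mu> (member \<Psi> k) + d k"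
    by metis
  define F' where "F' m = F (fst (prod_decode m)) (snd (prod_decode m))" for m
  have "bis \<Psi> k \<subseteq> (\<Union>m. ultra_set U (F' m))" if "k \<in> idx \<Psi>" for k
  proof
    fix x assume "x \<in> bis \<Psi> k"
    then obtain l where "x \<in> ultra_set U (F k l)" using F(3)[of k] \<open>k \<in> idx \<Psi>\<close> by (auto simp: member_def)
    then have "x \<in> ultra_set U (F' (prod_encode (k, l)))" by (simp add: F'_def)
    then show "x \<in> (\<Union>m. ultra_set U (F' m))" by blast
  qed
  moreover have "(\<Sum>m. ?\<mu> (ultra_set U (F' m))) \<le> graphing_cost GU \<Psi> + ennreal e"
  proof -
    define f where "f = (\<lambda>(k, l). ?\<mu> (ultra_set U (F k l)))"
    have "(\<Sum>m. ?\<mu> (ultra_set U (F' m))) = (\<Sum>m. f (prod_decode m))"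
      by (simp add: F'_def f_def case_prod_unfold)
    also have "\<dots> = (\<Sum>k. \<Sum>l. ?\<mu> (ultra_set U (F k l)))"
      by (rule suminf_ennreal_2dimen) (simp add: f_def)
    also have "\<dots> \<le> (\<Sum>k. ?\<mu> (member \<Psi> k) + d k)"
      by (intro suminf_le summableI F(4))
    also have "\<dots> = graphing_cost GU \<Psi> + ennreal e"
      by (simp add: graphing_cost_suminf d_sum flip: suminf_add[OF summableI summableI])
    finally show ?thesis .
  qed
  ultimately show ?thesis using F(1,2) by (intro exI[of _ F']) (auto simp: F'_def)
qed

text \<open>The tail of \<open>\<Phi>\<^sub>n\<close> is kept; by the assumption on the costs it is cheap in the limit. The other
  members of \<open>\<Phi>\<^sub>n\<close>, finite in number, are words in the internal bisections covering \<open>\<Psi>\<close>, by saturation.\<close>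

lemma ex_coarse_cost_le:
  assumes cost: "Lim U (\<lambda>n. graphing_cost (G n) (\<Phi> n)) = graphing_cost GU (ultra_graphing U \<Phi>)"
    and fin: "graphing_cost GU (ultra_graphing U \<Phi>) < \<infinity>"
    and \<Psi>: "is_graphing GU \<Psi>" "generating GU \<Psi>" "graphing_cost GU \<Psi> < \<infinity>" and e: "0 < (e :: real)"
  shows "\<exists>M. Lim U (\<lambda>n. coarse_cost M (G n) (\<Phi> n)) \<le> graphing_cost GU \<Psi> + ennreal e + ennreal e"
proof -
  obtain F where F: "\<And>m::nat. F m \<in> bounded_seqs" "\<And>m n. bisection (G n) (F m n)"
    and F_cover: "\<And>k. k \<in> idx \<Psi> \<Longrightarrow> bis \<Psi> k \<subseteq> (\<Union>m. ultra_set U (F m))"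
    and F_cost: "(\<Sum>m. emeasure (arrows GU) (ultra_set U (F m))) \<le> graphing_cost GU \<Psi> + ennreal e"
    using graphing_cover[OF \<Psi>(1,3) e] by blast
  \<comment> \<open>The auxiliary graphing numbers the covering bisections from 1, whence the
    shift.\<close>
  define \<Theta> where "\<Theta> n = \<lparr>idx = {1..}, bis = (\<lambda>i. F (i - 1) n)\<rparr>" for n
  have \<Theta>: "is_graphing (G n) (\<Theta> n)" for n
    by (simp add: is_graphing_def \<Theta>_def F)
  have \<Theta>_bounded: "(\<lambda>n. member (\<Theta> n) k) \<in> bounded_seqs" for k
    by (cases "k = 0") (simp_all add: member_def \<Theta>_def F bounded_seqs_empty flip: One_nat_def)
  have \<Theta>u: "is_graphing GU (ultra_graphing U \<Theta>)"
    by (rule is_graphing_ultra[OF \<Theta> \<Theta>_bounded])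
  \<comment> \<open>The covering sets contain the members of \<open>\<Psi>\<close>, which generate
    exactly, so words in them exhaust the carrier with no exceptional null set.\<close>
  have "carrier GU \<subseteq> (\<Union>m. ultra_set U (\<lambda>n. words_upto (G n) (\<Theta> n) m))" (is "_ \<subseteq> ?W")
  proof -
    have W: "subgroupoid GU ?W"
      using GU.subgroupoid_words[OF is_graphing_carrier[OF \<Theta>u]] unfolding words_upto_GU[of \<Theta>, OF \<Theta>] .
    have "ultra_set U (F m) \<subseteq> ?W" for m
    proof -
      have "ultra_set U (F m) \<subseteq> ultra_set U (\<lambda>n. words_upto (G n) (\<Theta> n) (Suc m))"
      proof (rule ultra_set_mono)
        fix n
        have "bis (\<Theta> n) (Suc m) \<subseteq> words_upto (G n) (\<Theta> n) (Suc m)"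
          by (rule P.bis_subset_words_upto[OF is_graphing_carrier[OF \<Theta>]]) (simp_all add: \<Theta>_def)
        moreover have "bis (\<Theta> n) (Suc m) = F m n" by (simp add: \<Theta>_def)
        ultimately show "F m n \<subseteq> words_upto (G n) (\<Theta> n) (Suc m)" by simp
      qed
      then show ?thesis by blast
    qed
    then have FW: "(\<Union>m. ultra_set U (F m)) \<subseteq> ?W" by (rule UN_least)
    have "(\<Union>k\<in>idx \<Psi>. bis \<Psi> k) \<subseteq> ?W"
      by (rule UN_least) (rule order_trans[OF F_cover FW])
    then have "subgroupoid GU hull (\<Union>k\<in>idx \<Psi>. bis \<Psi> k) \<subseteq> ?W"
      using W by (rule hull_minimal)
    then show ?thesis using \<Psi>(2) by (simp add: generating_def)
  qed
  moreover have "ultra_set U (\<lambda>n. member (\<Phi> n) k) \<subseteq> carrier GU" for k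
    using ultra_set_bounded_subset member_bounded[of k] unfolding carrier_GU by blast
  \<comment> \<open>The internal set of the k-th members is covered by a sequence of internal sets
    of words, so saturation bounds the word level for almost all \<open>n\<close>.\<close>
  ultimately have "\<forall>k. \<exists>m. \<forall>\<^sub>F n in U. member (\<Phi> n) k \<subseteq> (\<Union>i<m. words_upto (G n) (\<Theta> n) i)"
    by (intro allI saturation) blast
  then obtain m where m: "\<And>k. \<forall>\<^sub>F n in U. member (\<Phi> n) k \<subseteq> (\<Union>i<m k. words_upto (G n) (\<Theta> n) i)"
    by metis
  define c where "c k n = emeasure (arrows (G n)) (member (\<Phi> n) k)" for k n
  have c_cost: "graphing_cost (G n) (\<Phi> n) = (\<Sum>k. c k n)" for n
    by (simp add: graphing_cost_suminf c_def)
  have c_costu: "graphing_cost GU (ultra_graphing U \<Phi>) = (\<Sum>k. Lim U (c k))"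
    unfolding c_def by (rule ultra_graphing_cost[OF is_graphing_\<Phi> member_bounded])
  \<comment> \<open>The series of ultralimits is finite; \<open>K\<close> is chosen where less than
    \<open>e\<close> of it remains.\<close>
  obtain K where K: "(\<Sum>k. Lim U (c k)) < (\<Sum>k<K. Lim U (c k)) + ennreal e"
  proof -
    have "(\<lambda>K. (\<Sum>k<K. Lim U (c k)) + ennreal e) \<longlonglongrightarrow> (\<Sum>k. Lim U (c k)) + ennreal e"
      by (intro tendsto_add tendsto_const summable_LIMSEQ summableI)
    moreover have "(\<Sum>k. Lim U (c k)) < (\<Sum>k. Lim U (c k)) + ennreal e"
      using fin e ennreal_add_left_cancel_less[of "\<Sum>k. Lim U (c k)" 0 "ennreal e"] by (simp add: c_costu)
    ultimately have "\<forall>\<^sub>F K in sequentially. (\<Sum>k. Lim U (c k)) < (\<Sum>k<K. Lim U (c k)) + ennreal e"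
      by (rule order_tendstoD(1))
    then show ?thesis using that by (auto simp: eventually_sequentially)
  qed
  define tail where "tail n = (\<Sum>i. c (i + K) n)" for n
  have tail: "Lim U tail \<le> ennreal e"
  proof -
    \<comment> \<open>The cost hypothesis equates the series of ultralimits with the ultralimit of
      the series. Splitting the latter at \<open>K\<close> and cancelling the first \<open>K\<close>
      terms bounds the limit of the tails.\<close>
    have "(\<Sum>k. Lim U (c k)) = Lim U (\<lambda>n. (\<Sum>k<K. c k n) + tail n)"
      unfolding tail_def ennreal_suminf_split[of "\<lambda>k. c k _" K, symmetric]
      by (simp add: cost flip: c_costu c_cost)
    also have "\<dots> = (\<Sum>k<K. Lim U (c k)) + Lim U tail"
      by (simp add: Lim_ultra_add Lim_ultra_sum)
    finally have "(\<Sum>k<K. Lim U (c k)) + Lim U tail < (\<Sum>k<K. Lim U (c k)) + ennreal e"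
      using K by simp
    then show ?thesis
      unfolding ennreal_add_left_cancel_less by (blast intro: less_imp_le)
  qed
  \<comment> \<open>\<open>J\<close> is at least every \<open>m k\<close> with \<open>k < K\<close>,
    so the words found above involve only \<open>F 0, ..., F (J - 1)\<close>; the summand
    \<open>K\<close> keeps the tail indices below the bounds in \<open>M\<close>.\<close>
  define J where "J = K + (\<Sum>k<K. m k)"
  have mJ: "m k \<le> J" if "k < K" for k
    using member_le_sum[of k "{..<K}" m] that by (simp add: J_def)
  have "\<forall>i. \<exists>L. \<forall>n. F i n \<subseteq> wball L n"
    using F(1) by (auto simp: bounded_seqs_def)
  then obtain L where L: "\<And>i n. F i n \<subseteq> wball (L i) n" by metis
  \<comment> \<open>One sequence, independent of \<open>n\<close>, bounds the lengths of the
    \<open>F i\<close>, the tail indices in \<open>\<Phi> n\<close> and in \<open>\<Psi>' n\<close>,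
    and the word levels for the first \<open>K\<close> members.\<close>
  define M where "M i = i + Suc J + (\<Sum>i<J. L i)" for i
  \<comment> \<open>Indices \<open>1..J\<close> carry \<open>F 0, ..., F (J - 1)\<close>, and index
    \<open>J + 1 + i\<close> carries member \<open>K + i\<close> of \<open>\<Phi> n\<close>.\<close>
  define \<Psi>' where "\<Psi>' n = \<lparr>idx = {1..}, bis = (\<lambda>i. if i \<le> J then F (i - 1) n else member (\<Phi> n) (i - Suc J + K))\<rparr>" for n
  have \<Psi>': "is_graphing (G n) (\<Psi>' n)" for n
    by (simp add: is_graphing_def \<Psi>'_def F bisection_member[OF is_graphing_\<Phi>])
  have le: "coarse_le (G n) M (\<Psi>' n) (\<Phi> n)" for n
  proof (rule coarse_leI)
    fix k assume "k \<in> idx (\<Psi>' n)"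
    then have k: "1 \<le> k" by (simp add: \<Psi>'_def)
    show "bis (\<Psi>' n) k \<subseteq> wball (M k) n"
    proof (cases "k \<le> J")
      case True
      then have "L (k - 1) \<le> (\<Sum>i<J. L i)" using k by (intro member_le_sum) auto
      then have "wball (L (k - 1)) n \<subseteq> wball (M k) n" by (intro words_upto_mono) (simp add: M_def)
      then show ?thesis using L[of "k - 1" n] True by (simp add: \<Psi>'_def)
    next
      case False
      let ?j = "k - Suc J + K"
      show ?thesis
      proof (cases "?j \<in> idx (\<Phi> n)")
        case True
        then have "bis (\<Phi> n) ?j \<subseteq> wball (M k) n"
          using \<open>\<not> k \<le> J\<close> by (intro P.bis_subset_words_upto[OF is_graphing_carrier[OF is_graphing_\<Phi>]])
            (auto simp: M_def J_def)
        then show ?thesis using False True by (simp add: \<Psi>'_def member_def)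
      qed (use False in \<open>simp add: \<Psi>'_def member_def\<close>)
    qed
  qed
  have "\<forall>\<^sub>F n in U. \<forall>k\<in>{..<K}. member (\<Phi> n) k \<subseteq> (\<Union>i<m k. words_upto (G n) (\<Theta> n) i)"
    using m by (intro eventually_ball_finite) auto
  \<comment> \<open>The reverse inclusion is obtained for almost all \<open>n\<close>, namely where
    saturation covers the first \<open>K\<close> members.\<close>
  then have le_ev: "\<forall>\<^sub>F n in U. coarse_cost M (G n) (\<Phi> n) \<le> graphing_cost (G n) (\<Psi>' n)"
  proof eventually_elim
    case (elim n)
    have ge: "coarse_le (G n) M (\<Phi> n) (\<Psi>' n)"
    proof (rule coarse_leI)
      fix k assume k: "k \<in> idx (\<Phi> n)"
      show "bis (\<Phi> n) k \<subseteq> words_upto (G n) (\<Psi>' n) (M k)"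
      proof (cases "k < K")
        case True
        have "words_upto (G n) (\<Theta> n) i \<subseteq> words_upto (G n) (\<Psi>' n) (M k)" if "i < m k" for i
        proof -
          have "words_upto (G n) (\<Theta> n) i \<subseteq> words_upto (G n) (\<Psi>' n) i"
            using mJ[OF True] that by (intro words_upto_graphing_mono) (auto simp: \<Theta>_def \<Psi>'_def)
          also have "\<dots> \<subseteq> words_upto (G n) (\<Psi>' n) (M k)"
            using mJ[OF True] that by (intro words_upto_mono) (simp add: M_def)
          finally show ?thesis .
        qed
        moreover have "bis (\<Phi> n) k \<subseteq> (\<Union>i<m k. words_upto (G n) (\<Theta> n) i)"
          using bspec[OF elim, of k] True k by (simp add: member_def)
        ultimately show ?thesis by blast
      next
        case False
        let ?i = "k - K + Suc J"
        have i: "\<not> ?i \<le> J" "?i - Suc J + K = k" using False by simp_all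
        have "bis (\<Psi>' n) ?i = member (\<Phi> n) (?i - Suc J + K)"
          unfolding \<Psi>'_def using i(1) by (simp only: graphing.select_convs if_False)
        then have "bis (\<Psi>' n) ?i = bis (\<Phi> n) k" using k by (simp only: i(2) member_def if_True)
        moreover have "bis (\<Psi>' n) ?i \<subseteq> words_upto (G n) (\<Psi>' n) (M k)"
          by (intro P.bis_subset_words_upto[OF is_graphing_carrier[OF \<Psi>']]) (auto simp: \<Psi>'_def M_def)
        ultimately show ?thesis by simp
      qed
    qed
    show ?case
      unfolding coarse_cost_def using le[of n] ge \<Psi>'[of n] by (intro Inf_lower) (auto simp: coarse_equiv_def)
  qed
  have cost_\<Psi>': "graphing_cost (G n) (\<Psi>' n) = (\<Sum>i<J. emeasure (arrows (G n)) (F i n)) + tail n" for n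
  proof -
    have "graphing_cost (G n) (\<Psi>' n) = (\<Sum>i<Suc J. emeasure (arrows (G n)) (member (\<Psi>' n) i))
        + (\<Sum>i. emeasure (arrows (G n)) (member (\<Psi>' n) (i + Suc J)))"
      unfolding graphing_cost_suminf by (rule ennreal_suminf_split)
    also have "(\<Sum>i. emeasure (arrows (G n)) (member (\<Psi>' n) (i + Suc J))) = tail n"
    proof -
      have "member (\<Psi>' n) (i + Suc J) = member (\<Phi> n) (i + K)" for i
      proof -
        have i: "\<not> i + Suc J \<le> J" "i + Suc J - Suc J + K = i + K" by simp_all
        have "member (\<Psi>' n) (i + Suc J) = bis (\<Psi>' n) (i + Suc J)"
          by (simp add: member_def \<Psi>'_def)
        also have "\<dots> = member (\<Phi> n) (i + K)"
          unfolding \<Psi>'_def using i(1) by (simp only: graphing.select_convs if_False i(2))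
        finally show ?thesis .
      qed
      then show ?thesis unfolding tail_def c_def by simp
    qed
    \<comment> \<open>Index 0 contributes the empty set, so the shifted sum starts with
      \<open>F 0\<close>.\<close>
    also have "(\<Sum>i<Suc J. emeasure (arrows (G n)) (member (\<Psi>' n) i)) = (\<Sum>i<J. emeasure (arrows (G n)) (F i n))"
      unfolding sum.lessThan_Suc_shift by (simp add: member_def \<Psi>'_def)
    finally show ?thesis .
  qed
  from le_ev have "Lim U (\<lambda>n. coarse_cost M (G n) (\<Phi> n)) \<le> Lim U (\<lambda>n. graphing_cost (G n) (\<Psi>' n))"
    by (rule Lim_ultra_mono)
  also have "\<dots> = (\<Sum>i<J. emeasure (arrows GU) (ultra_set U (F i))) + Lim U tail"
    by (simp add: cost_\<Psi>' Lim_ultra_add Lim_ultra_sum GU_ultra_set(2)[OF F(1)])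
  also have "\<dots> \<le> (graphing_cost GU \<Psi> + ennreal e) + ennreal e"
    by (intro add_mono tail order_trans[OF sum_le_suminf[OF summableI] F_cost]) auto
  finally show ?thesis by blast
qed

theorem combinatorial_cost_eq:
  assumes cost: "Lim U (\<lambda>n. graphing_cost (G n) (\<Phi> n)) = graphing_cost GU (ultra_graphing U \<Phi>)"
    and fin: "graphing_cost GU (ultra_graphing U \<Phi>) < \<infinity>"
  shows "combinatorial_cost U G \<Phi> = groupoid_cost GU"
proof (rule antisym)
  show "groupoid_cost GU \<le> combinatorial_cost U G \<Phi>"
    unfolding combinatorial_cost_def by (intro INF_greatest GU_cost_le_Lim_coarse_cost)
  show "combinatorial_cost U G \<Phi> \<le> groupoid_cost GU"
    unfolding groupoid_cost_def
  proof (rule Inf_greatest)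
    fix x assume "x \<in> {graphing_cost GU \<Psi> |\<Psi>. is_graphing GU \<Psi> \<and> generating GU \<Psi>}"
    then obtain \<Psi> where x: "x = graphing_cost GU \<Psi>" and \<Psi>: "is_graphing GU \<Psi>" "generating GU \<Psi>" by blast
    show "combinatorial_cost U G \<Phi> \<le> x"
    proof (rule ennreal_le_epsilon)
      fix e :: real assume "x < top" "0 < e"
      \<comment> \<open>One \<open>e/2\<close> is spent on the cover and one on the tail.\<close>
      then obtain M where "Lim U (\<lambda>n. coarse_cost M (G n) (\<Phi> n)) \<le> x + ennreal (e/2) + ennreal (e/2)"
        using ex_coarse_cost_le[OF cost fin \<Psi>, of "e/2"] x by auto
      also have "\<dots> = x + ennreal e"
        using \<open>0 < e\<close> by (simp add: add.assoc flip: ennreal_plus)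
      finally show "combinatorial_cost U G \<Phi> \<le> x + ennreal e"
        unfolding combinatorial_cost_def by (intro INF_lower2[of M]) auto
    qed
  qed
qed

lemma Lim_groupoid_cost_le: "Lim U (\<lambda>n. groupoid_cost (G n)) \<le> combinatorial_cost U G \<Phi>"
  unfolding combinatorial_cost_def
  by (intro INF_greatest Lim_ultra_mono always_eventually allI P.groupoid_cost_le_coarse_cost
      is_graphing_\<Phi> generating_\<Phi>)

end

theorem theorem1p2:
  fixes U :: "nat filter"
    and G :: "nat \<Rightarrow> 'a groupoid"
    and \<Phi> :: "nat \<Rightarrow> 'a graphing"
  assumes "nonprincipal_ultrafilter U"
    and "\<And>n. pmp_graphed_groupoid (G n) (\<Phi> n)"
    and "Lim U (\<lambda>n. graphing_cost (G n) (\<Phi> n)) =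
           graphing_cost (ultra_groupoid U G \<Phi>) (ultra_graphing U \<Phi>)"
    and "graphing_cost (ultra_groupoid U G \<Phi>) (ultra_graphing U \<Phi>) < \<infinity>"
  shows "combinatorial_cost U G \<Phi> = groupoid_cost (ultra_groupoid U G \<Phi>) \<and>
         groupoid_cost (ultra_groupoid U G \<Phi>) \<ge> Lim U (\<lambda>n. groupoid_cost (G n))"
proof -
  interpret graphed_groupoid_seq U G \<Phi>
    using assms(1,2) by unfold_locales
  show ?thesis
    using combinatorial_cost_eq[OF assms(3,4)] Lim_groupoid_cost_le by simp
qed

end
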